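(* Let $\mathbb G=\{\mathcal G\in\mathbb K^{N\times N\times p}:\mathcal G^\star=\mathcal G^{-1}\}$ be the automorphism group associated with one of the following spaces $\mathbb K^{N\times1\times p}$, tensors $\mathcal T\in\mathbb K^{N\times N\times p}$ and form types: bilinear forms: $(\mathbb R^{n\times1\times p},\mathcal I)$, $(\mathbb C^{n\times1\times p},\mathcal I)$, $(\mathbb R^{n\times1\times p},\Sigma_{a,b})$, $(\mathbb C^{n\times1\times p},\Sigma_{a,b})$, $(\mathbb R^{n\times1\times p},\mathcal R_n)$, $(\mathbb R^{2n\times1\times p},\mathcal J)$, $(\mathbb C^{2n\times1\times p},\mathcal J)$; sesquilinear forms: $(\mathbb C^{n\times1\times p},\mathcal I)$, $(\mathbb C^{n\times1\times p},\Sigma_{a,b})$, $(\mathbb C^{n\times1\times p},\mathcal R_n)$, $(\mathbb C^{2n\times1\times p},\mathcal J)$. If $\mathcal A\in\mathbb G$, and $f:\mathbb R\to\mathbb R$ is defined for $x>0$ and satisfies $$f(x)f\!\left(\tfrac1x\right)=1\ (x>0)\quad\text{and}\quad f(0)=0,$$ then $f^{\Diamond}(\mathcal A)\in\mathbb G$.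
   Context: T-product. For $\mathcal A\in\mathbb C^{m\times n\times p}$ with frontal slices $A^{(1)},\dots,A^{(p)}\in\mathbb C^{m\times n}$, $\mathrm{unfold}(\mathcal A)\in\mathbb C^{mp\times n}$ is the vertical stack of $A^{(1)},\dots,A^{(p)}$, $\mathrm{fold}$ is its inverse, and $\mathrm{bcirc}(\mathcal A)\in\mathbb C^{mp\times np}$ is the block circulant matrix whose $(a,b)$ block is $A^{(((a-b)\bmod p)+1)}$; $\mathrm{bcirc}^{-1}$ is the inverse of $\mathrm{bcirc}$ on its image. For $\mathcal B\in\mathbb C^{n\times s\times p}$, $\mathcal A*\mathcal B=\mathrm{fold}(\mathrm{bcirc}(\mathcal A)\,\mathrm{unfold}(\mathcal B))$. $\mathcal A^\top$ (resp. $\mathcal A^H$) is obtained by transposing (resp. conjugate transposing) each frontal slice and reversing the order of slices $2,\dots,p$. The identity tensor $\mathcal I=\mathcal I_{nnp}$ has first frontal slice $I_n$ and other slices zero; inverses and unitary tensors ($\mathcal Q^H*\mathcal Q=\mathcal Q*\mathcal Q^H=\mathcal I$) are with respect to $*$. Generalized tensor function. $F_p=p^{-1/2}(\omega^{jk})_{j,k=0}^{p-1}$ with $\omega=e^{-2\pi\mathbf i/p}$. A T-SVD is $\mathcal A=\mathcal U*\mathcal S*\mathcal V^H$ with $\mathcal U,\mathcal V$ unitary, $\mathcal S$ F-diagonal (every frontal slice diagonal) and $\mathrm{bcirc}(\mathcal S)=(F_p\otimes I_m)\mathrm{diag}(\Sigma_1,\dots,\Sigma_p)(F_p^H\otimes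 I_n)$, where each $\Sigma_i\in\mathbb R^{m\times n}$ is diagonal with nonnegative entries. For a scalar function $f$, $f^{\Diamond}(\mathcal A)=\mathcal U*\hat f(\mathcal S)*\mathcal V^H$ with $\hat f(\mathcal S)=\mathrm{bcirc}^{-1}\big((F_p\otimes I_m)\mathrm{diag}(\tilde f(\Sigma_1),\dots,\tilde f(\Sigma_p))(F_p^H\otimes I_n)\big)$ and $\tilde f(\Sigma_i)=f(\sqrt{\Sigma_i\Sigma_i^H})(\sqrt{\Sigma_i\Sigma_i^H})^\dagger\Sigma_i$, i.e. $\tilde f(\Sigma_i)$ is diagonal, with $f(\sigma)$ in place of each diagonal entry $\sigma>0$ and $0$ in place of each diagonal entry $0$. Special tensors and adjoint. $\mathcal R_n\in\mathbb R^{n\times n\times p}$ has first frontal slice the $n\times n$ matrix with ones on the antidiagonal and zeros elsewhere, and other slices zero. $\mathcal J=\begin{bmatrix}0&\mathcal I_{nnp}\\-\mathcal I_{nnp}&0\end{bmatrix}\in\mathbb R^{2n\times2n\times p}$ and $\Sigma_{a,b}=\begin{bmatrix}\mathcal I_{aap}&0\\0&-\mathcal I_{bbp}\end{bmatrix}\in\mathbb R^{n\times n\times p}$ with $a+b=n$ (block tensors are formed slice by slice from the frontal slices). The scalar product is $\langle x,y\rangle_{\mathcal T}=x^\top*\mathcal T*y$ for bilinear forms and $x^H*\mathcal T*y$ for sesquilinear forms, and the adjoint is $\mathcal A^\star=\mathcal T^{-1}*\mathcal A^\top*\mathcal T$ for bilinear forms and $\mathcal A^\star=\mathcal T^{-1}*\mathcal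 A^H*\mathcal T$ for sesquilinear forms. *)

theory Defs
  imports Complex_Main "Jordan_Normal_Form.Schur_Decomposition"
begin

(* A third-order tensor of size m x n x p is the list of its p frontal slices, all m x n.
   Slices, rows, columns and blocks are numbered from 0. *)

type_synonym 'a tensor = "'a mat list"

abbreviation slice_rows :: "'a tensor \<Rightarrow> nat" where
  "slice_rows A \<equiv> dim_row (hd A)"

abbreviation slice_cols :: "'a tensor \<Rightarrow> nat" where
  "slice_cols A \<equiv> dim_col (hd A)"

(* Real tensors are the complex tensors with entries in K = \<real>; K = UNIV gives all of them. *)

definition carrier_tensor :: "complex set \<Rightarrow> nat \<Rightarrow> nat \<Rightarrow> nat \<Rightarrow> complex tensor set" where
  "carrier_tensor K m n p =
     {A. length A = p \<and> (\<forall>X \<in> set A. X \<in> carrier_mat m n \<and> elements_mat X \<subseteq> K)}"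

definition unfold_tensor :: "'a tensor \<Rightarrow> 'a mat" where
  "unfold_tensor A =
     (let m = slice_rows A
      in mat (m * length A) (slice_cols A) (\<lambda>(i, j). (A ! (i div m)) $$ (i mod m, j)))"

definition fold_tensor :: "nat \<Rightarrow> 'a mat \<Rightarrow> 'a tensor" where
  "fold_tensor p M =
     (let m = dim_row M div p
      in map (\<lambda>k. mat m (dim_col M) (\<lambda>(i, j). M $$ (k * m + i, j))) [0..<p])"

(* With a = i div m and b = j div n both below p, the term (a + p - b) mod p is the
   non-negative residue of a - b; nat subtraction does not truncate here. *)

definition bcirc :: "'a tensor \<Rightarrow> 'a mat" where
  "bcirc A =
     (let m = slice_rows A; n = slice_cols A; p = length A
      in mat (m * p) (n * p)
           (\<lambda>(i, j). (A ! ((i div m + p - j div n) mod p)) $$ (i mod m, j mod n)))"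

definition bcirc_inv :: "nat \<Rightarrow> nat \<Rightarrow> nat \<Rightarrow> complex mat \<Rightarrow> complex tensor" where
  "bcirc_inv m n p = inv_into (carrier_tensor UNIV m n p) bcirc"

lemma fold_unfold_tensor:
  assumes "A \<in> carrier_tensor K m n p" and "0 < p"
  shows "fold_tensor p (unfold_tensor A) = A"
proof -
  have len: "length A = p" and car: "\<And>k. k < p \<Longrightarrow> A ! k \<in> carrier_mat m n"
    using assms by (auto simp: carrier_tensor_def)
  have hd: "hd A = A ! 0" using len assms(2) by (cases A) auto
  have dims: "slice_rows A = m" "slice_cols A = n" using car[OF assms(2)] hd by auto
  show ?thesis
  proof (rule nth_equalityI)
    show "length (fold_tensor p (unfold_tensor A)) = length A"
      by (simp add: fold_tensor_def Let_def len)
  next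
    fix k assume "k < length (fold_tensor p (unfold_tensor A))"
    then have k: "k < p" by (simp add: fold_tensor_def Let_def)
    have bound: "k * m + i < m * p" if "i < m" for i
    proof -
      have "k * m + i < Suc k * m" using that by simp
      also have "\<dots> \<le> p * m" using k by (intro mult_le_mono1) simp
      finally show ?thesis by (simp add: mult.commute)
    qed
    show "fold_tensor p (unfold_tensor A) ! k = A ! k"
      using car[OF k] k assms(2) bound
      by (intro eq_matI) (auto simp: fold_tensor_def unfold_tensor_def Let_def dims len)
  qed
qed

lemma inj_on_bcirc:
  assumes "0 < p"
  shows "inj_on bcirc (carrier_tensor K m n p)"
proof (rule inj_onI)
  fix A B assume A: "A \<in> carrier_tensor K m n p" and B: "B \<in> carrier_tensor K m n p"
    and eq: "bcirc A = bcirc B"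
  have len: "length A = p" "length B = p"
    and car: "\<And>k. k < p \<Longrightarrow> A ! k \<in> carrier_mat m n" "\<And>k. k < p \<Longrightarrow> B ! k \<in> carrier_mat m n"
    using A B by (auto simp: carrier_tensor_def)
  have hd: "hd A = A ! 0" "hd B = B ! 0" using len assms by (cases A; cases B; auto)+
  have dims: "slice_rows A = m" "slice_cols A = n" "slice_rows B = m" "slice_cols B = n"
    using car[OF assms] hd by auto
  show "A = B"
  proof (rule nth_equalityI)
    fix k assume "k < length A"
    then have k: "k < p" using len by simp
    show "A ! k = B ! k"
    proof (rule eq_matI)
      fix i j assume "i < dim_row (B ! k)" "j < dim_col (B ! k)"
      then have i: "i < m" and j: "j < n" using car[OF k] by auto
      have "k * m + i < Suc k * m" using i by simp
      also have "\<dots> \<le> p * m" using k by (intro mult_le_mono1) simp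
      finally have bi: "k * m + i < m * p" by (simp add: mult.commute)
      have bj: "j < n * p" using j assms by (metis Suc_leI le_trans less_le_trans mult_le_mono2 mult.right_neutral One_nat_def order_refl)
      have "bcirc A $$ (k * m + i, j) = bcirc B $$ (k * m + i, j)" using eq by simp
      then show "A ! k $$ (i, j) = B ! k $$ (i, j)"
        using bi bj i j k by (simp add: bcirc_def Let_def dims len)
    qed (use car[OF k] in auto)
  qed (simp add: len)
qed

definition tprod :: "'a::semiring_0 tensor \<Rightarrow> 'a tensor \<Rightarrow> 'a tensor" (infixl "*\<^sub>t" 70) where
  "A *\<^sub>t B = fold_tensor (length A) (bcirc A * unfold_tensor B)"

definition transpose_tensor :: "'a tensor \<Rightarrow> 'a tensor" where
  "transpose_tensor A = map transpose_mat (take 1 A @ rev (drop 1 A))"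

definition adjoint_tensor :: "complex tensor \<Rightarrow> complex tensor" where
  "adjoint_tensor A = map mat_adjoint (take 1 A @ rev (drop 1 A))"

definition first_slice_tensor :: "nat \<Rightarrow> complex mat \<Rightarrow> complex tensor" where
  "first_slice_tensor p M = M # replicate (p - 1) (0\<^sub>m (dim_row M) (dim_col M))"

definition id_tensor :: "nat \<Rightarrow> nat \<Rightarrow> complex tensor" where
  "id_tensor n p = first_slice_tensor p (1\<^sub>m n)"

definition zero_tensor :: "nat \<Rightarrow> nat \<Rightarrow> nat \<Rightarrow> complex tensor" where
  "zero_tensor m n p = replicate p (0\<^sub>m m n)"

definition inverse_tensor_of :: "complex tensor \<Rightarrow> complex tensor \<Rightarrow> bool" where
  "inverse_tensor_of A B \<longleftrightarrow>
     (let n = slice_rows A; p = length A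
      in A \<in> carrier_tensor UNIV n n p \<and> B \<in> carrier_tensor UNIV n n p \<and>
         A *\<^sub>t B = id_tensor n p \<and> B *\<^sub>t A = id_tensor n p)"

definition invertible_tensor :: "complex tensor \<Rightarrow> bool" where
  "invertible_tensor A \<longleftrightarrow> (\<exists>B. inverse_tensor_of A B)"

definition inv_tensor :: "complex tensor \<Rightarrow> complex tensor" where
  "inv_tensor A = (THE B. inverse_tensor_of A B)"

definition unitary_tensor :: "nat \<Rightarrow> nat \<Rightarrow> complex tensor \<Rightarrow> bool" where
  "unitary_tensor n p Q \<longleftrightarrow>
     Q \<in> carrier_tensor UNIV n n p \<and>
     adjoint_tensor Q *\<^sub>t Q = id_tensor n p \<and> Q *\<^sub>t adjoint_tensor Q = id_tensor n p"

definition dft_mat :: "nat \<Rightarrow> complex mat" where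
  "dft_mat p =
     mat p p (\<lambda>(j, k). exp (- 2 * of_real pi * \<i> / of_nat p) ^ (j * k) / of_real (sqrt (real p)))"

definition kronecker_mat :: "'a::times mat \<Rightarrow> 'a mat \<Rightarrow> 'a mat" where
  "kronecker_mat A B =
     mat (dim_row A * dim_row B) (dim_col A * dim_col B)
       (\<lambda>(i, j). A $$ (i div dim_row B, j div dim_col B) * B $$ (i mod dim_row B, j mod dim_col B))"

definition fourier_blocks :: "nat \<Rightarrow> nat \<Rightarrow> nat \<Rightarrow> real mat list \<Rightarrow> complex mat" where
  "fourier_blocks m n p Ds =
     kronecker_mat (dft_mat p) (1\<^sub>m m) * diag_block_mat (map (map_mat complex_of_real) Ds) *
     kronecker_mat (mat_adjoint (dft_mat p)) (1\<^sub>m n)"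

definition tsvd :: "complex tensor \<Rightarrow> complex tensor \<Rightarrow> complex tensor \<Rightarrow> complex tensor \<Rightarrow>
    real mat list \<Rightarrow> bool" where
  "tsvd A U S V Ds \<longleftrightarrow>
     (let m = slice_rows A; n = slice_cols A; p = length A
      in A \<in> carrier_tensor UNIV m n p \<and>
         unitary_tensor m p U \<and> unitary_tensor n p V \<and>
         S \<in> carrier_tensor UNIV m n p \<and> (\<forall>X \<in> set S. diagonal_mat X) \<and>
         length Ds = p \<and>
         (\<forall>D \<in> set Ds. D \<in> carrier_mat m n \<and> diagonal_mat D \<and> (\<forall>x \<in> elements_mat D. 0 \<le> x)) \<and>
         bcirc S = fourier_blocks m n p Ds \<and>
         A = U *\<^sub>t S *\<^sub>t adjoint_tensor V)"

(* A function of a square diagonal matrix. The functions sqrt and inverse give the positive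
   semidefinite square root and, because inverse 0 = 0, the Moore-Penrose inverse. *)

definition diag_fun :: "(real \<Rightarrow> real) \<Rightarrow> real mat \<Rightarrow> real mat" where
  "diag_fun g D = mat (dim_row D) (dim_col D) (\<lambda>(i, j). if i = j then g (D $$ (i, j)) else 0)"

definition gen_fun_mat :: "(real \<Rightarrow> real) \<Rightarrow> real mat \<Rightarrow> real mat" where
  "gen_fun_mat f D =
     (let R = diag_fun sqrt (D * transpose_mat D)
      in diag_fun f R * diag_fun inverse R * D)"

lemma gen_fun_mat_eq:
  assumes D: "D \<in> carrier_mat m n" and diag: "diagonal_mat D" and nn: "\<forall>x \<in> elements_mat D. 0 \<le> x"
  shows "gen_fun_mat f D = mat m n (\<lambda>(i, j). if 0 < D $$ (i, j) then f (D $$ (i, j)) else 0)"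
proof -
  define d where "d i = (if i < n then D $$ (i, i) else 0)" for i
  have Dij: "D $$ (i, j) = (if i = j then d i else 0)" if "i < m" "j < n" for i j
    using that diag D by (auto simp: diagonal_mat_def d_def)
  have d0: "0 \<le> d i" if "i < m" for i
    using that nn D by (auto simp: d_def intro: elements_matI)
  define R where "R = diag_fun sqrt (D * transpose_mat D)"
  have R: "R = mat m m (\<lambda>(i, j). if i = j then d i else 0)"
  proof (rule eq_matI; simp)
    fix i j assume i: "i < m" and j: "j < m"
    have "(\<Sum>k = 0..<n. D $$ (i, k) * D $$ (i, k)) = (\<Sum>k = 0..<n. if i = k then d i * d i else 0)"
      using i by (intro sum.cong) (auto simp: Dij)
    also have "\<dots> = d i * d i" by (auto simp: d_def)
    finally have "(D * transpose_mat D) $$ (i, i) = d i * d i"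
      using D i by (auto simp: scalar_prod_def)
    then show "(i = j \<longrightarrow> R $$ (j, j) = d j) \<and> (i \<noteq> j \<longrightarrow> R $$ (i, j) = 0)"
      using D i j d0 by (auto simp: R_def diag_fun_def)
  qed (use D in \<open>auto simp: R_def diag_fun_def\<close>)
  have P: "diag_fun f R * diag_fun inverse R =
      mat m m (\<lambda>(i, j). if i = j then f (d i) * inverse (d i) else 0)"
  proof (rule eq_matI)
    fix i j
    assume "i < dim_row (mat m m (\<lambda>(i, j). if i = j then f (d i) * inverse (d i) else 0))"
      and "j < dim_col (mat m m (\<lambda>(i, j). if i = j then f (d i) * inverse (d i) else 0))"
    then have i: "i < m" and j: "j < m" by auto
    have "(diag_fun f R * diag_fun inverse R) $$ (i, j) =
        (\<Sum>k = 0..<m. diag_fun f R $$ (i, k) * diag_fun inverse R $$ (k, j))"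
      using i j by (simp add: R diag_fun_def scalar_prod_def)
    also have "\<dots> = (\<Sum>k = 0..<m. if i = k then
        (if i = j then f (d i) * inverse (d i) else 0) else 0)"
      using i j by (intro sum.cong) (auto simp: R diag_fun_def)
    also have "\<dots> = (if i = j then f (d i) * inverse (d i) else 0)" using i by simp
    finally show "(diag_fun f R * diag_fun inverse R) $$ (i, j) =
        mat m m (\<lambda>(i, j). if i = j then f (d i) * inverse (d i) else 0) $$ (i, j)"
      using i j by simp
  qed (auto simp: R diag_fun_def)
  show ?thesis
  proof (rule eq_matI)
    fix i j
    assume "i < dim_row (mat m n (\<lambda>(i, j). if 0 < D $$ (i, j) then f (D $$ (i, j)) else 0))"
      and "j < dim_col (mat m n (\<lambda>(i, j). if 0 < D $$ (i, j) then f (D $$ (i, j)) else 0))"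
    then have i: "i < m" and j: "j < n" by auto
    have "gen_fun_mat f D $$ (i, j) =
        (\<Sum>k = 0..<m. (if i = k then f (d i) * inverse (d i) else 0) * D $$ (k, j))"
      using D i j by (simp add: gen_fun_mat_def Let_def R_def[symmetric] P scalar_prod_def)
    also have "\<dots> = (\<Sum>k = 0..<m. if i = k then f (d i) * inverse (d i) * D $$ (i, j) else 0)"
      by (intro sum.cong) auto
    also have "\<dots> = f (d i) * inverse (d i) * D $$ (i, j)" using i by simp
    also have "\<dots> = (if 0 < D $$ (i, j) then f (D $$ (i, j)) else 0)"
      using d0[OF i] by (auto simp: Dij[OF i j])
    finally show "gen_fun_mat f D $$ (i, j) =
        mat m n (\<lambda>(i, j). if 0 < D $$ (i, j) then f (D $$ (i, j)) else 0) $$ (i, j)"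
      using i j by simp
  qed (use D in \<open>auto simp: gen_fun_mat_def Let_def diag_fun_def\<close>)
qed

(* The value U * f(S) * V^H does not depend on the T-SVD chosen, so the definite description
   ranges over all of them. *)

definition gen_fun_tensor :: "(real \<Rightarrow> real) \<Rightarrow> complex tensor \<Rightarrow> complex tensor" where
  "gen_fun_tensor f A =
     (THE B. \<exists>U S V Ds. tsvd A U S V Ds \<and>
        B = U *\<^sub>t bcirc_inv (slice_rows A) (slice_cols A) (length A)
              (fourier_blocks (slice_rows A) (slice_cols A) (length A) (map (gen_fun_mat f) Ds))
            *\<^sub>t adjoint_tensor V)"

definition block_tensor :: "complex tensor \<Rightarrow> complex tensor \<Rightarrow> complex tensor \<Rightarrow> complex tensor \<Rightarrow>
    complex tensor" where
  "block_tensor A B C D =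
     map (\<lambda>k. four_block_mat (A ! k) (B ! k) (C ! k) (D ! k)) [0..<length A]"

definition reversal_tensor :: "nat \<Rightarrow> nat \<Rightarrow> complex tensor" where
  "reversal_tensor n p =
     first_slice_tensor p (mat n n (\<lambda>(i, j). if i + j + 1 = n then 1 else 0))"

definition symplectic_tensor :: "nat \<Rightarrow> nat \<Rightarrow> complex tensor" where
  "symplectic_tensor n p =
     block_tensor (zero_tensor n n p) (id_tensor n p)
       (map uminus (id_tensor n p)) (zero_tensor n n p)"

definition signature_tensor :: "nat \<Rightarrow> nat \<Rightarrow> nat \<Rightarrow> complex tensor" where
  "signature_tensor a b p =
     block_tensor (id_tensor a p) (zero_tensor a b p)
       (zero_tensor b a p) (map uminus (id_tensor b p))"

datatype form_type = Bilinear | Sesquilinear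

fun star_adjoint :: "form_type \<Rightarrow> complex tensor \<Rightarrow> complex tensor \<Rightarrow> complex tensor" where
  "star_adjoint Bilinear T A = inv_tensor T *\<^sub>t transpose_tensor A *\<^sub>t T"
| "star_adjoint Sesquilinear T A = inv_tensor T *\<^sub>t adjoint_tensor A *\<^sub>t T"

definition automorphism_group ::
    "complex set \<Rightarrow> nat \<Rightarrow> nat \<Rightarrow> complex tensor \<Rightarrow> form_type \<Rightarrow> complex tensor set" where
  "automorphism_group K N p T \<phi> =
     {G \<in> carrier_tensor K N N p. invertible_tensor G \<and> star_adjoint \<phi> T G = inv_tensor G}"

inductive classical_space ::
    "complex set \<Rightarrow> nat \<Rightarrow> nat \<Rightarrow> complex tensor \<Rightarrow> form_type \<Rightarrow> bool" where
  "classical_space \<real> n p (id_tensor n p) Bilinear"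
| "classical_space UNIV n p (id_tensor n p) Bilinear"
| "a + b = n \<Longrightarrow> classical_space \<real> n p (signature_tensor a b p) Bilinear"
| "a + b = n \<Longrightarrow> classical_space UNIV n p (signature_tensor a b p) Bilinear"
| "classical_space \<real> n p (reversal_tensor n p) Bilinear"
| "classical_space \<real> (2 * n) p (symplectic_tensor n p) Bilinear"
| "classical_space UNIV (2 * n) p (symplectic_tensor n p) Bilinear"
| "classical_space UNIV n p (id_tensor n p) Sesquilinear"
| "a + b = n \<Longrightarrow> classical_space UNIV n p (signature_tensor a b p) Sesquilinear"
| "classical_space UNIV n p (reversal_tensor n p) Sesquilinear"
| "classical_space UNIV (2 * n) p (symplectic_tensor n p) Sesquilinear"

end

theory Submission
  imports Defs
begin

text \<open>The map \<open>bcirc\<close> embeds the tensors under the T-product into the matrices as a *-algebra, and a T-SVD of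
  \<open>A\<close> becomes an SVD \<open>M = W D X\<^sup>H\<close> of \<open>M = bcirc A\<close>, with \<open>bcirc (f\<^sup>\<diamond> A) = W f(D) X\<^sup>H\<close>. If \<open>f 0 = 0\<close>, this matrix does not
  depend on the SVD: for two SVDs the unitary matrices \<open>Y = W'\<^sup>H W\<close> and \<open>Z = X'\<^sup>H X\<close> satisfy \<open>Y D = D' Z\<close>
  and \<open>Z D = D' Y\<close>, so entrywise \<open>Y f(D) = f(D') Z\<close>. For every space in the list, \<open>T\<close> is real and unitary, so
  \<open>A\<^sup>\<star> = A\<^sup>-\<^sup>1\<close> rewrites \<open>M\<close> as the product of \<open>T\<close>, the adjoint (or transpose) of \<open>M\<^sup>-\<^sup>1\<close>, and \<open>T\<^sup>-\<^sup>1\<close>. This yields an SVD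
  of \<open>M\<close> with the singular values \<open>1 / \<sigma>\<close>. Computing \<open>f\<^sup>\<diamond>\<close> from it, with \<open>f (1 / \<sigma>) = 1 / f \<sigma>\<close>, gives the same
  relation for \<open>f\<^sup>\<diamond> A\<close>. A T-SVD exists because the Fourier transform makes \<open>bcirc A\<close> block diagonal, and
  each (invertible) diagonal block has an SVD by the spectral theorem.\<close>

section \<open>Complex matrices and their singular value decompositions\<close>

lemma dim_mat_adjoint [simp]:
  "dim_row (mat_adjoint A) = dim_col A" "dim_col (mat_adjoint A) = dim_row A"
  by (auto simp: mat_adjoint_def)

lemma index_mat_adjoint [simp]:
  "i < dim_col A \<Longrightarrow> j < dim_row A \<Longrightarrow> mat_adjoint A $$ (i, j) = conjugate (A $$ (j, i))"
  by (auto simp: mat_adjoint_def mat_of_rows_index)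

lemma mat_adjoint_carrier [simp]:
  "mat_adjoint A \<in> carrier_mat m n \<longleftrightarrow> A \<in> carrier_mat n m"
  unfolding carrier_mat_def by auto

lemma mat_adjoint_mat_adjoint [simp]: "mat_adjoint (mat_adjoint A) = A"
  by (rule eq_matI) auto

lemma mat_adjoint_one [simp]: "mat_adjoint (1\<^sub>m n :: complex mat) = 1\<^sub>m n"
  by (rule eq_matI) auto

lemma mat_adjoint_mult:
  fixes A B :: "complex mat"
  assumes "A \<in> carrier_mat m n" and "B \<in> carrier_mat n k"
  shows "mat_adjoint (A * B) = mat_adjoint B * mat_adjoint A"
  using assms by (intro eq_matI) (auto simp: scalar_prod_def mult.commute)

lemma transpose_cnj: "transpose_mat (map_mat cnj A) = mat_adjoint A"
  by (rule eq_matI) auto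

lemma map_cnj_mult:
  fixes A B :: "complex mat"
  assumes "A \<in> carrier_mat m n" and "B \<in> carrier_mat n k"
  shows "map_mat cnj (A * B) = map_mat cnj A * map_mat cnj B"
  using assms by (intro eq_matI) (auto simp: scalar_prod_def)

lemma map_cnj_adjoint: "map_mat cnj (mat_adjoint A) = transpose_mat A"
  by (rule eq_matI) auto

lemma mat_adjoint_map_cnj: "mat_adjoint (map_mat cnj A) = transpose_mat A"
  by (rule eq_matI) auto

section \<open>Unitary matrices\<close>

definition unitary_mat :: "nat \<Rightarrow> complex mat \<Rightarrow> bool" where
  "unitary_mat n U \<longleftrightarrow>
     U \<in> carrier_mat n n \<and> mat_adjoint U * U = 1\<^sub>m n \<and> U * mat_adjoint U = 1\<^sub>m n"

text \<open>For square matrices a left inverse is also a right inverse, so one of the two equations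
  is enough.\<close>

lemma unitary_matI:
  assumes "U \<in> carrier_mat n n" and "mat_adjoint U * U = 1\<^sub>m n"
  shows "unitary_mat n U"
  using assms mat_mult_left_right_inverse[of "mat_adjoint U" n U] by (simp add: unitary_mat_def)

lemma unitary_mat_adjoint: "unitary_mat n U \<Longrightarrow> unitary_mat n (mat_adjoint U)"
  by (simp add: unitary_mat_def)

lemma mult_square_carrier [simp]:
  "A \<in> carrier_mat n n \<Longrightarrow> B \<in> carrier_mat n n \<Longrightarrow> A * B \<in> carrier_mat n n"
  by (rule mult_carrier_mat)

lemma mult_cancel_left_inverse:
  fixes A B C :: "'a::semiring_1 mat"
  assumes "B * A = 1\<^sub>m n" "A \<in> carrier_mat n n" "B \<in> carrier_mat n n" "C \<in> carrier_mat n k"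
  shows "B * (A * C) = C"
proof -
  have "B * (A * C) = (B * A) * C" using assms by (intro assoc_mult_mat[symmetric])
  also have "\<dots> = C" unfolding assms(1) using assms(4) by (rule left_mult_one_mat)
  finally show ?thesis .
qed

lemma unitary_mat_cancel:
  assumes "unitary_mat n U" and "B \<in> carrier_mat n k"
  shows "mat_adjoint U * (U * B) = B" "U * (mat_adjoint U * B) = B"
  using assms mult_cancel_left_inverse[of "mat_adjoint U" U n B k]
    mult_cancel_left_inverse[of U "mat_adjoint U" n B k] by (auto simp: unitary_mat_def)

lemma unitary_mat_mult:
  assumes U: "unitary_mat n U" and V: "unitary_mat n V"
  shows "unitary_mat n (U * V)"
proof (rule unitary_matI)
  have [simp]: "U \<in> carrier_mat n n" "V \<in> carrier_mat n n" using U V by (auto simp: unitary_mat_def)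
  show "U * V \<in> carrier_mat n n" by simp
  show "mat_adjoint (U * V) * (U * V) = 1\<^sub>m n"
    using V by (simp add: mat_adjoint_mult[of _ n n _ n] unitary_mat_cancel[OF U, of _ n] unitary_mat_def
        assoc_mult_mat[of _ n n _ n _ n])
qed

lemma unitary_mat_map_cnj:
  assumes "unitary_mat n U"
  shows "unitary_mat n (map_mat cnj U)"
proof (rule unitary_matI)
  have U: "U \<in> carrier_mat n n" "mat_adjoint U * U = 1\<^sub>m n" using assms by (auto simp: unitary_mat_def)
  then show "map_mat cnj U \<in> carrier_mat n n" by simp
  have "map_mat cnj (mat_adjoint U * U) = mat_adjoint (map_mat cnj U) * map_mat cnj U"
    using U(1) by (subst map_cnj_mult[of _ n n _ n]) (auto simp: map_cnj_adjoint mat_adjoint_map_cnj)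
  moreover have "map_mat cnj (1\<^sub>m n) = 1\<^sub>m n" by (rule eq_matI) auto
  ultimately show "mat_adjoint (map_mat cnj U) * map_mat cnj U = 1\<^sub>m n" using U(2) by simp
qed

section \<open>Real diagonal matrices and singular value decompositions\<close>

definition real_diag :: "nat \<Rightarrow> (nat \<Rightarrow> real) \<Rightarrow> complex mat" where
  "real_diag n d = mat n n (\<lambda>(i, j). if i = j then complex_of_real (d i) else 0)"

lemma real_diag_carrier [simp]: "real_diag n d \<in> carrier_mat n n"
  by (simp add: real_diag_def)

lemma mult_real_diag_index:
  assumes "A \<in> carrier_mat m n" "i < m" "j < n"
  shows "(A * real_diag n d) $$ (i, j) = A $$ (i, j) * of_real (d j)"
  using assms by (simp add: real_diag_def scalar_prod_def if_distrib[of "\<lambda>x. _ * x"] cong: if_cong)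

lemma real_diag_mult_index:
  assumes "A \<in> carrier_mat n k" "i < n" "j < k"
  shows "(real_diag n d * A) $$ (i, j) = of_real (d i) * A $$ (i, j)"
  using assms by (simp add: real_diag_def scalar_prod_def if_distrib[of "\<lambda>x. x * _"] cong: if_cong)

lemma real_diag_mult:
  "real_diag n d * real_diag n e = real_diag n (\<lambda>i. d i * e i)"
proof (rule eq_matI)
  fix i j assume "i < dim_row (real_diag n (\<lambda>i. d i * e i))" "j < dim_col (real_diag n (\<lambda>i. d i * e i))"
  then have ij: "i < n" "j < n" by (auto simp: real_diag_def)
  show "(real_diag n d * real_diag n e) $$ (i, j) = real_diag n (\<lambda>i. d i * e i) $$ (i, j)"
    by (subst mult_real_diag_index[of _ n n]) (use ij in \<open>auto simp: real_diag_def\<close>)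
qed (auto simp: real_diag_def)

lemma real_diag_adjoint [simp]: "mat_adjoint (real_diag n d) = real_diag n d"
  by (rule eq_matI) (auto simp: real_diag_def)

lemma real_diag_transpose [simp]: "transpose_mat (real_diag n d) = real_diag n d"
  by (rule eq_matI) (auto simp: real_diag_def)

lemma real_diag_cnj [simp]: "map_mat cnj (real_diag n d) = real_diag n d"
  by (rule eq_matI) (auto simp: real_diag_def)

lemma real_diag_eq_one: "(\<And>i. i < n \<Longrightarrow> d i = 1) \<Longrightarrow> real_diag n d = 1\<^sub>m n"
  by (rule eq_matI) (auto simp: real_diag_def)

text \<open>The entries of \<open>d\<close> need not be sorted. Hence singular values may be listed
  Fourier block by Fourier block, and replacing each by its reciprocal causes no reordering.\<close>

definition svd_mat ::
    "nat \<Rightarrow> complex mat \<Rightarrow> complex mat \<Rightarrow> (nat \<Rightarrow> real) \<Rightarrow> complex mat \<Rightarrow> bool" where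
  "svd_mat n M W d X \<longleftrightarrow>
     unitary_mat n W \<and> unitary_mat n X \<and> (\<forall>i<n. 0 \<le> d i) \<and>
     M = W * real_diag n d * mat_adjoint X"

lemma svd_matD:
  assumes "svd_mat n M W d X"
  shows "unitary_mat n W" "unitary_mat n X" "\<And>i. i < n \<Longrightarrow> 0 \<le> d i"
    "M = W * real_diag n d * mat_adjoint X" "W \<in> carrier_mat n n" "X \<in> carrier_mat n n"
    "M \<in> carrier_mat n n"
  using assms by (auto simp: svd_mat_def unitary_mat_def)

text \<open>Taking adjoints exchanges the two unitary factors; this supplies the second of the two
  intertwining relations used for uniqueness.\<close>

lemma svd_mat_adjoint:
  assumes "svd_mat n M W d X"
  shows "svd_mat n (mat_adjoint M) X d W"
proof -
  note c = svd_matD[OF assms]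
  have "mat_adjoint M = X * (real_diag n d * mat_adjoint W)"
    using c(5,6) unfolding c(4) by (simp add: mat_adjoint_mult[of _ n n _ n])
  then show ?thesis
    using c(1,2,3,5,6) by (simp add: svd_mat_def assoc_mult_mat[of X n n _ n "mat_adjoint W" n])
qed

text \<open>Multiply the equation between the two decompositions by \<open>mat_adjoint W'\<close> on
  the left and by \<open>X\<close> on the right.\<close>

lemma svd_mat_intertwine:
  assumes s: "svd_mat n M W d X" and s': "svd_mat n M W' d' X'"
  shows "(mat_adjoint W' * W) * real_diag n d = real_diag n d' * (mat_adjoint X' * X)"
proof -
  note c = svd_matD[OF s] and c' = svd_matD[OF s']
  note [simp] = c(5,6) c'(5,6)
  have "W * real_diag n d * mat_adjoint X = W' * real_diag n d' * mat_adjoint X'"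
    using c(4) c'(4) by simp
  then have "mat_adjoint W' * (W * real_diag n d * mat_adjoint X) * X =
      mat_adjoint W' * (W' * real_diag n d' * mat_adjoint X') * X" by simp
  moreover have "mat_adjoint W' * (W * real_diag n d * mat_adjoint X) * X =
      (mat_adjoint W' * W) * real_diag n d"
    using c(2) by (simp add: assoc_mult_mat[of _ n n _ n _ n] unitary_mat_def
        right_mult_one_mat[of _ n n])
  moreover have "mat_adjoint W' * (W' * real_diag n d' * mat_adjoint X') * X =
      real_diag n d' * (mat_adjoint X' * X)"
    by (simp add: assoc_mult_mat[of _ n n _ n _ n] unitary_mat_cancel[OF c'(1), of _ n])
  ultimately show ?thesis by simp
qed

text \<open>The two intertwining relations give \<open>y * d j = d' i * z\<close> and
  \<open>z * d j = d' i * y\<close> for the entries \<open>y\<close> of \<open>Y\<close> and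
  \<open>z\<close> of \<open>Z\<close>. Together they show that the difference of the squares of
  \<open>d j\<close> and \<open>d' i\<close> annihilates both \<open>y\<close> and \<open>z\<close>.
  As singular values are nonnegative, either \<open>d j = d' i\<close> or \<open>y = z = 0\<close>,
  and in both cases the relation survives the application of \<open>f\<close>.\<close>

lemma svd_mat_fun_unique:
  assumes s: "svd_mat n M W d X" and s': "svd_mat n M W' d' X'" and f0: "f 0 = 0"
  shows "W * real_diag n (\<lambda>i. f (d i)) * mat_adjoint X =
         W' * real_diag n (\<lambda>i. f (d' i)) * mat_adjoint X'"
proof -
  note c = svd_matD[OF s] and c' = svd_matD[OF s']
  note [simp] = c(5,6) c'(5,6)
  define Y where "Y = mat_adjoint W' * W"
  define Z where "Z = mat_adjoint X' * X"
  have YZ [simp]: "Y \<in> carrier_mat n n" "Z \<in> carrier_mat n n" by (simp_all add: Y_def Z_def)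
  have 1: "Y * real_diag n d = real_diag n d' * Z"
    unfolding Y_def Z_def by (rule svd_mat_intertwine[OF s s'])
  have 2: "Z * real_diag n d = real_diag n d' * Y"
    unfolding Y_def Z_def by (rule svd_mat_intertwine[OF svd_mat_adjoint[OF s] svd_mat_adjoint[OF s']])
  have "Y * real_diag n (\<lambda>i. f (d i)) = real_diag n (\<lambda>i. f (d' i)) * Z"
  proof (rule eq_matI)
    fix i j
    assume "i < dim_row (real_diag n (\<lambda>i. f (d' i)) * Z)" "j < dim_col (real_diag n (\<lambda>i. f (d' i)) * Z)"
    then have ij: "i < n" "j < n" using carrier_matD(2)[OF YZ(2)] by (auto simp: real_diag_def)
    define y where "y = Y $$ (i, j)"
    define z where "z = Z $$ (i, j)"
    have e1: "y * of_real (d j) = of_real (d' i) * z"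
      using arg_cong[OF 1, of "\<lambda>A. A $$ (i, j)"] ij
      by (simp add: mult_real_diag_index[of _ n n] real_diag_mult_index[of _ n n] y_def z_def del: index_mult_mat)
    have e2: "z * of_real (d j) = of_real (d' i) * y"
      using arg_cong[OF 2, of "\<lambda>A. A $$ (i, j)"] ij
      by (simp add: mult_real_diag_index[of _ n n] real_diag_mult_index[of _ n n] y_def z_def del: index_mult_mat)
    have "y * of_real (f (d j)) = of_real (f (d' i)) * z"
    proof (cases "d j = d' i")
      case True
      \<comment> \<open>A common nonzero value cancels and gives \<open>y = z\<close>. At the common
        value 0 the entries \<open>y\<close> and \<open>z\<close> are unrelated, and
        \<open>f 0 = 0\<close> makes both sides vanish.\<close>
      then show ?thesis using e1 f0 by (cases "d j = 0") auto
    next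
      case False
      have "(d j)\<^sup>2 \<noteq> (d' i)\<^sup>2"
        using False c(3)[of j] c'(3)[of i] ij by (simp add: power2_eq_iff_nonneg)
      then have "complex_of_real ((d j)\<^sup>2 - (d' i)\<^sup>2) \<noteq> 0"
        by (metis of_real_eq_0_iff right_minus_eq)
      moreover have "y * of_real ((d j)\<^sup>2 - (d' i)\<^sup>2) = 0" "z * of_real ((d j)\<^sup>2 - (d' i)\<^sup>2) = 0"
      proof -
        have "y * of_real (d j) * of_real (d j) = of_real (d' i) * (of_real (d' i) * y)"
          using e1 e2 by (metis mult.assoc)
        then show "y * of_real ((d j)\<^sup>2 - (d' i)\<^sup>2) = 0" by (simp add: algebra_simps power2_eq_square)
        have "z * of_real (d j) * of_real (d j) = of_real (d' i) * (of_real (d' i) * z)"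
          using e1 e2 by (metis mult.assoc)
        then show "z * of_real ((d j)\<^sup>2 - (d' i)\<^sup>2) = 0" by (simp add: algebra_simps power2_eq_square)
      qed
      ultimately have "y = 0" "z = 0" by (simp_all only: mult_eq_0_iff simp_thms)
      then show ?thesis by simp
    qed
    then show "(Y * real_diag n (\<lambda>i. f (d i))) $$ (i, j) = (real_diag n (\<lambda>i. f (d' i)) * Z) $$ (i, j)"
      using ij by (simp add: mult_real_diag_index[of _ n n] real_diag_mult_index[of _ n n] y_def z_def del: index_mult_mat)
  qed (use carrier_matD[OF YZ(1)] carrier_matD[OF YZ(2)] in \<open>auto simp: real_diag_def\<close>)
  then have "W' * (Y * real_diag n (\<lambda>i. f (d i))) * mat_adjoint X =
      W' * (real_diag n (\<lambda>i. f (d' i)) * Z) * mat_adjoint X" by simp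
  moreover have "W' * (Y * real_diag n (\<lambda>i. f (d i))) * mat_adjoint X =
      W * real_diag n (\<lambda>i. f (d i)) * mat_adjoint X"
    by (simp add: Y_def assoc_mult_mat[of _ n n _ n _ n] unitary_mat_cancel[OF c'(1), of _ n])
  moreover have "W' * (real_diag n (\<lambda>i. f (d' i)) * Z) * mat_adjoint X =
      W' * real_diag n (\<lambda>i. f (d' i)) * mat_adjoint X'"
    using c(2) by (simp add: Z_def assoc_mult_mat[of _ n n _ n _ n] unitary_mat_def
        right_mult_one_mat[of _ n n])
  ultimately show ?thesis by simp
qed

section \<open>Existence: unitary completion, the spectral theorem, and the SVD of an invertible
  matrix\<close>

lemma mat_adjoint_mult_self_index:
  fixes B :: "complex mat"
  assumes "B \<in> carrier_mat m n" and "i < n"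
  shows "(mat_adjoint B * B) $$ (i, i) = of_real (\<Sum>k<m. (cmod (B $$ (k, i)))\<^sup>2)"
  using assms
  by (auto simp: scalar_prod_def atLeast0LessThan complex_norm_square mult.commute simp del: of_real_power
      intro!: sum.cong)

text \<open>Extend \<open>v\<close> to a basis and apply Gram-Schmidt, which keeps the first vector.
  The result is orthogonal but not normalised, so the columns are scaled afterwards and the first
  one becomes a multiple of \<open>v\<close>.\<close>

lemma unitary_completion:
  fixes v :: "complex vec"
  assumes v: "v \<in> carrier_vec n" and v0: "v \<noteq> 0\<^sub>v n" and n: "0 < n"
  obtains W c where "unitary_mat n W" "col W 0 = c \<cdot>\<^sub>v v"
proof -
  interpret cof_vec_space n "TYPE(complex)" .
  define b where "b = basis_completion v"
  define ws where "ws = gram_schmidt n b"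
  from basis_completion[OF v v0, folded b_def]
  have b: "set b \<subseteq> carrier_vec n" "distinct b" "\<not> lin_dep (set b)" "hd b = v" "length b = n"
    by auto
  then obtain vs where bv: "b = v # vs" using n by (cases b) auto
  from gram_schmidt_result[OF b(1,2,3) refl, folded ws_def]
  have ws: "set ws \<subseteq> carrier_vec n" "corthogonal ws" "length ws = n" by (auto simp: b(5))
  have "hd ws = v" using gram_schmidt_hd[OF v, of vs] unfolding ws_def bv .
  then have ws0: "ws ! 0 = v" using ws(3) n by (cases ws) auto
  define s where "s j = (\<Sum>k<n. (cmod (ws ! j $ k))\<^sup>2)" for j
  have wsc: "ws ! j \<in> carrier_vec n" if "j < n" for j using ws that by auto
  have self: "ws ! j \<bullet>c ws ! j = of_real (s j)" if "j < n" for j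
    using wsc[OF that]
    by (auto simp: s_def scalar_prod_def atLeast0LessThan complex_norm_square simp del: of_real_power
        intro!: sum.cong)
  \<comment> \<open>\<open>corthogonal\<close> also says that no vector of the list is orthogonal to
    itself, so the squared norms \<open>s j\<close> do not vanish.\<close>
  have s0: "0 < s j" if "j < n" for j
  proof -
    have "ws ! j \<bullet>c ws ! j \<noteq> 0" using ws(2,3) that by (auto simp: corthogonal_def)
    then have "s j \<noteq> 0" using self[OF that] by auto
    moreover have "0 \<le> s j" by (auto simp: s_def intro: sum_nonneg)
    ultimately show ?thesis by simp
  qed
  define W where "W = mat n n (\<lambda>(i, j). of_real (1 / sqrt (s j)) * ws ! j $ i)"
  have W: "W \<in> carrier_mat n n" by (simp add: W_def)
  have "mat_adjoint W * W = 1\<^sub>m n"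
  proof (rule eq_matI)
    fix i j assume "i < dim_row (1\<^sub>m n :: complex mat)" "j < dim_col (1\<^sub>m n :: complex mat)"
    then have ij: "i < n" "j < n" by auto
    have "(mat_adjoint W * W) $$ (i, j) =
        (\<Sum>k<n. cnj (of_real (1 / sqrt (s i)) * ws ! i $ k) * (of_real (1 / sqrt (s j)) * ws ! j $ k))"
      using ij W by (auto simp: scalar_prod_def atLeast0LessThan W_def)
    also have "\<dots> = of_real (1 / sqrt (s i)) * of_real (1 / sqrt (s j)) * (ws ! j \<bullet>c ws ! i)"
      using wsc[OF ij(1)] wsc[OF ij(2)]
      by (auto simp: scalar_prod_def atLeast0LessThan sum_distrib_left mult_ac intro!: sum.cong)
    also have "\<dots> = (if i = j then 1 else 0)"
    proof (cases "i = j")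
      case True
      have "sqrt (s j) * sqrt (s j) = s j" using s0[OF ij(2)] by simp
      then have "1 / sqrt (s j) * (1 / sqrt (s j)) * s j = 1" using s0[OF ij(2)]
        by (simp add: field_simps)
      then have "complex_of_real (1 / sqrt (s j) * (1 / sqrt (s j)) * s j) = 1" by simp
      then show ?thesis using True self[OF ij(2)] by (simp only: of_real_mult simp_thms if_True)
    next
      case False
      then have "ws ! j \<bullet>c ws ! i = 0" using ws(2,3) ij by (auto simp: corthogonal_def)
      then show ?thesis using False by simp
    qed
    finally show "(mat_adjoint W * W) $$ (i, j) = 1\<^sub>m n $$ (i, j)" using ij by simp
  qed (use W in auto)
  then have "unitary_mat n W" by (rule unitary_matI[OF W])
  moreover have "col W 0 = of_real (1 / sqrt (s 0)) \<cdot>\<^sub>v v"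
    using n v by (intro eq_vecI) (auto simp: W_def ws0)
  ultimately show thesis by (rule that)
qed

lemma four_block_diag_mult:
  assumes "A \<in> carrier_mat a a" "C \<in> carrier_mat a a" "B \<in> carrier_mat b b" "D \<in> carrier_mat b b"
  shows "four_block_mat A (0\<^sub>m a b) (0\<^sub>m b a) B * four_block_mat C (0\<^sub>m a b) (0\<^sub>m b a) D =
    four_block_mat (A * C) (0\<^sub>m a b) (0\<^sub>m b a) (B * D)"
  using assms
  by (subst mult_four_block_mat[of A a a _ b _ b B C a _ b])
    (auto simp: left_mult_zero_mat[of C a a] left_mult_zero_mat[of D b b]
      right_mult_zero_mat[of A a a] right_mult_zero_mat[of B b b] left_add_zero_mat[of _ b b]
      right_add_zero_mat[of _ a a])

text \<open>Deflation: a unitary \<open>W\<close> whose first column is an eigenvector turns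
  \<open>H\<close> into a Hermitian matrix with first column \<open>e\<close> times the first unit
  vector. Symmetry clears the first row as well, and the induction hypothesis diagonalises the
  remaining block.\<close>

lemma hermitian_spectral:
  fixes H :: "complex mat"
  assumes "H \<in> carrier_mat n n" and "mat_adjoint H = H"
  shows "\<exists>V d. unitary_mat n V \<and> H = V * real_diag n d * mat_adjoint V"
  using assms
proof (induction n arbitrary: H)
  case 0
  have "unitary_mat 0 (1\<^sub>m 0)" by (simp add: unitary_mat_def)
  moreover have "H = 1\<^sub>m 0 * real_diag 0 (\<lambda>_. 0) * mat_adjoint (1\<^sub>m 0)"
    using 0 by (intro eq_matI) (auto simp: real_diag_def)
  ultimately show ?case by blast
next
  case (Suc n)
  note H [simp] = Suc.prems(1)
  have "degree (char_poly H) = Suc n" using degree_monic_char_poly[OF H] by simp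
  then have "\<not> constant (poly (char_poly H))" by (simp add: constant_degree)
  then obtain e where "poly (char_poly H) e = 0" using fundamental_theorem_of_algebra by blast
  then have "eigenvalue H e" by (simp add: eigenvalue_root_char_poly[OF H])
  then obtain v where v: "v \<in> carrier_vec (Suc n)" "v \<noteq> 0\<^sub>v (Suc n)" "H *\<^sub>v v = e \<cdot>\<^sub>v v"
    using H unfolding eigenvalue_def eigenvector_def by auto
  obtain W c where W: "unitary_mat (Suc n) W" and Wv: "col W 0 = c \<cdot>\<^sub>v v"
    using unitary_completion[OF v(1,2)] by auto
  have Wc [simp]: "W \<in> carrier_mat (Suc n) (Suc n)" using W by (simp add: unitary_mat_def)
  define A where "A = mat_adjoint W * (H * W)"
  have A [simp]: "A \<in> carrier_mat (Suc n) (Suc n)" by (simp add: A_def)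
  have Aherm: "mat_adjoint A = A"
    by (simp add: A_def mat_adjoint_mult[of _ "Suc n" "Suc n" _ "Suc n"] Suc.prems(2)
        assoc_mult_mat[of _ "Suc n" "Suc n" _ "Suc n" _ "Suc n"])
  \<comment> \<open>The first column of \<open>W\<close> is an eigenvector, so \<open>H\<close>
    scales it by \<open>e\<close>, and \<open>mat_adjoint W\<close> maps it to the first unit
    vector.\<close>
  have "col A 0 = mat_adjoint W *\<^sub>v (H *\<^sub>v col W 0)"
    by (simp add: A_def col_mult2[of _ "Suc n" "Suc n" _ "Suc n"])
  also have "H *\<^sub>v col W 0 = e \<cdot>\<^sub>v col W 0"
    using v by (simp add: Wv mult_mat_vec[OF H] smult_smult_assoc mult.commute)
  also have "mat_adjoint W *\<^sub>v (e \<cdot>\<^sub>v col W 0) = e \<cdot>\<^sub>v (mat_adjoint W *\<^sub>v col W 0)"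
    by (intro mult_mat_vec[of _ "Suc n" "Suc n"]) (simp_all add: Wv v(1))
  also have "mat_adjoint W *\<^sub>v col W 0 = col (mat_adjoint W * W) 0"
    by (simp add: col_mult2[of _ "Suc n" "Suc n" _ "Suc n"])
  also have "\<dots> = col (1\<^sub>m (Suc n)) 0" using W by (simp add: unitary_mat_def)
  finally have colA: "col A 0 = e \<cdot>\<^sub>v col (1\<^sub>m (Suc n)) 0" .
  have A0: "A $$ (i, 0) = (if i = 0 then e else 0)" if "i < Suc n" for i
    using arg_cong[OF colA, of "\<lambda>x. x $ i"] that A by (auto simp del: A simp: carrier_matD[OF A])
  have A0': "A $$ (0, i) = cnj (A $$ (i, 0))" if "i < Suc n" for i
    using arg_cong[OF Aherm, of "\<lambda>x. x $$ (0, i)"] that carrier_matD[OF A] by simp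
  \<comment> \<open>The eigenvalue is a diagonal entry of the Hermitian matrix \<open>A\<close>,
    hence real.\<close>
  have "cnj e = e" using A0[of 0] A0'[of 0] by simp
  then have e: "cnj e = e" "of_real (Re e) = e" by (simp_all add: complex_eq_iff)
  define H' where "H' = mat n n (\<lambda>(i, j). A $$ (Suc i, Suc j))"
  have H': "H' \<in> carrier_mat n n" by (simp add: H'_def)
  have "mat_adjoint H' = H'"
  proof (rule eq_matI)
    fix i j assume "i < dim_row H'" "j < dim_col H'"
    then have ij: "i < n" "j < n" by (auto simp: H'_def)
    show "mat_adjoint H' $$ (i, j) = H' $$ (i, j)"
      using arg_cong[OF Aherm, of "\<lambda>x. x $$ (Suc i, Suc j)"] ij carrier_matD[OF A]
      by (simp add: H'_def)
  qed (auto simp: H'_def)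
  from Suc.IH[OF H' this] obtain V d where V: "unitary_mat n V"
    and H'V: "H' = V * real_diag n d * mat_adjoint V" by blast
  have Vc [simp]: "V \<in> carrier_mat n n" using V by (simp add: unitary_mat_def)
  \<comment> \<open>The diagonalising matrix of the smaller block, extended by the identity on the
    first coordinate, where \<open>A\<close> is already diagonal.\<close>
  define P where "P = four_block_mat (1\<^sub>m 1) (0\<^sub>m 1 n) (0\<^sub>m n 1) V"
  define d' where "d' i = (case i of 0 \<Rightarrow> Re e | Suc k \<Rightarrow> d k)" for i
  have P [simp]: "P \<in> carrier_mat (Suc n) (Suc n)"
    using four_block_carrier_mat[of "1\<^sub>m 1" 1 1 V n n] by (simp add: P_def)
  have Padj: "mat_adjoint P = four_block_mat (1\<^sub>m 1) (0\<^sub>m 1 n) (0\<^sub>m n 1) (mat_adjoint V)"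
    using carrier_matD[OF Vc] by (intro eq_matI) (auto simp: P_def)
  have D: "real_diag (Suc n) d' =
      four_block_mat (real_diag 1 (\<lambda>_. Re e)) (0\<^sub>m 1 n) (0\<^sub>m n 1) (real_diag n d)"
    by (rule eq_matI) (auto simp: real_diag_def d'_def split: nat.split)
  have "mat_adjoint P * P = four_block_mat (1\<^sub>m 1 * 1\<^sub>m 1) (0\<^sub>m 1 n) (0\<^sub>m n 1) (mat_adjoint V * V)"
    unfolding Padj unfolding P_def by (rule four_block_diag_mult) auto
  also have "\<dots> = 1\<^sub>m (Suc n)"
    using V four_block_one_mat[of 1 n] by (simp add: unitary_mat_def left_mult_one_mat[of _ "Suc 0" "Suc 0"])
  finally have P_unitary: "unitary_mat (Suc n) P" by (intro unitary_matI) auto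
  have "P * real_diag (Suc n) d' * mat_adjoint P =
      four_block_mat (real_diag 1 (\<lambda>_. Re e)) (0\<^sub>m 1 n) (0\<^sub>m n 1) H'"
    unfolding Padj D unfolding P_def H'V
    by (subst four_block_diag_mult; (subst four_block_diag_mult)?) (simp_all add: left_mult_one_mat[of _ 1 1]
        right_mult_one_mat[of _ 1 1] del: One_nat_def)
  also have "\<dots> = A"
    using A0 A0' e carrier_matD[OF A]
    by (intro eq_matI) (auto simp: real_diag_def H'_def)
  finally have AP: "A = P * real_diag (Suc n) d' * mat_adjoint P" ..
  have "W * (A * mat_adjoint W) = H"
    using W by (simp add: A_def assoc_mult_mat[of _ "Suc n" "Suc n" _ "Suc n" _ "Suc n"]
        unitary_mat_cancel[OF W, of _ "Suc n"] right_mult_one_mat[of _ "Suc n" "Suc n"] unitary_mat_def)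
  then have "H = (W * P) * real_diag (Suc n) d' * mat_adjoint (W * P)"
    unfolding AP by (simp add: mat_adjoint_mult[of _ "Suc n" "Suc n" _ "Suc n"]
        assoc_mult_mat[of _ "Suc n" "Suc n" _ "Suc n" _ "Suc n"])
  then show ?case using unitary_mat_mult[OF W P_unitary] by blast
qed

text \<open>If \<open>V\<close> diagonalises the Gram matrix of \<open>C\<close>, the columns of
  \<open>C * V\<close> are orthogonal with squared norms \<open>d i\<close>. Invertibility makes
  these norms positive, so normalising the columns yields the left unitary factor, and the square
  roots of \<open>d\<close> are the singular values.\<close>

lemma invertible_svd_mat:
  assumes C: "C \<in> carrier_mat n n" and E: "E \<in> carrier_mat n n" and EC: "E * C = 1\<^sub>m n"
  shows "\<exists>W d X. svd_mat n C W d X"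
proof -
  note [simp] = C E
  have "mat_adjoint (mat_adjoint C * C) = mat_adjoint C * C"
    by (simp add: mat_adjoint_mult[of _ n n _ n])
  then obtain V d where V: "unitary_mat n V" and CV: "mat_adjoint C * C = V * real_diag n d * mat_adjoint V"
    using hermitian_spectral[of "mat_adjoint C * C" n] by auto
  have [simp]: "V \<in> carrier_mat n n" using V by (simp add: unitary_mat_def)
  define B where "B = C * V"
  have B [simp]: "B \<in> carrier_mat n n" by (simp add: B_def)
  have "mat_adjoint B * B = mat_adjoint V * ((mat_adjoint C * C) * V)"
    by (simp add: B_def mat_adjoint_mult[of _ n n _ n] assoc_mult_mat[of _ n n _ n _ n])
  also have "\<dots> = real_diag n d"
    using V unfolding CV by (simp add: assoc_mult_mat[of _ n n _ n _ n] unitary_mat_cancel[OF V, of _ n]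
        right_mult_one_mat[of _ n n] unitary_mat_def)
  finally have BB: "mat_adjoint B * B = real_diag n d" .
  have d: "d i = (\<Sum>k<n. (cmod (B $$ (k, i)))\<^sup>2)" if "i < n" for i
  proof -
    have "complex_of_real (d i) = real_diag n d $$ (i, i)" using that by (simp add: real_diag_def)
    then show ?thesis
      unfolding BB[symmetric] mat_adjoint_mult_self_index[OF B that] by (simp only: of_real_eq_iff)
  qed
  have inv: "(mat_adjoint V * E) * B = 1\<^sub>m n"
    using V mult_cancel_left_inverse[OF EC C E, of V n]
    by (simp add: B_def assoc_mult_mat[of _ n n _ n _ n] unitary_mat_def)
  \<comment> \<open>If \<open>d i\<close> were 0, column \<open>i\<close> of \<open>B\<close> would
    vanish, contradicting the left inverse of \<open>B\<close>.\<close>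
  have d0: "0 < d i" if i: "i < n" for i
  proof (rule ccontr)
    assume "\<not> 0 < d i"
    then have "(\<Sum>k<n. (cmod (B $$ (k, i)))\<^sup>2) = 0"
      unfolding d[OF i] by (metis less_eq_real_def sum_nonneg zero_le_power2)
    then have "B $$ (k, i) = 0" if "k < n" for k
      using that by (simp add: sum_nonneg_eq_0_iff)
    then have "((mat_adjoint V * E) * B) $$ (i, i) = 0"
      using i carrier_matD[OF B] carrier_matD[OF E]
        carrier_matD[OF \<open>V \<in> carrier_mat n n\<close>] by (simp add: scalar_prod_def)
    then show False using i unfolding inv by simp
  qed
  define s where "s i = sqrt (d i)" for i
  define W where "W = B * real_diag n (\<lambda>i. 1 / s i)"
  have [simp]: "W \<in> carrier_mat n n" by (simp add: W_def)
  have "mat_adjoint W * W = real_diag n (\<lambda>i. 1 / s i) * ((mat_adjoint B * B) * real_diag n (\<lambda>i. 1 / s i))"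
    by (simp add: W_def mat_adjoint_mult[of _ n n _ n] assoc_mult_mat[of _ n n _ n _ n])
  also have "\<dots> = 1\<^sub>m n"
    unfolding BB real_diag_mult
  proof (rule real_diag_eq_one)
    fix i assume "i < n"
    with d0[of i] show "1 / s i * (d i * (1 / s i)) = 1" by (simp add: s_def)
  qed
  finally have W: "unitary_mat n W" by (intro unitary_matI) auto
  have "W * real_diag n s = B"
  proof -
    have "W * real_diag n s = B * (real_diag n (\<lambda>i. 1 / s i) * real_diag n s)"
      by (simp add: W_def assoc_mult_mat[of _ n n _ n _ n])
    also have "real_diag n (\<lambda>i. 1 / s i) * real_diag n s = 1\<^sub>m n"
      unfolding real_diag_mult
    proof (rule real_diag_eq_one)
      fix i assume "i < n"
      with d0[of i] show "1 / s i * s i = 1" by (simp add: s_def)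
    qed
    finally show ?thesis by (simp add: right_mult_one_mat[of _ n n])
  qed
  then have "C = W * real_diag n s * mat_adjoint V"
    using V by (simp add: B_def assoc_mult_mat[of _ n n _ n _ n] unitary_mat_def right_mult_one_mat[of _ n n])
  moreover have "0 \<le> s i" if "i < n" for i using d0[OF that] by (simp add: s_def)
  ultimately show ?thesis using W V unfolding svd_mat_def by blast
qed

section \<open>Block matrices and the algebra of block circulants\<close>

text \<open>In \<open>g a b i j\<close> the block position \<open>(a, b)\<close> comes first and the
  position \<open>(i, j)\<close> inside the block second. Identities between block matrices thereby
  become identities between entry functions, free of division and remainder.\<close>

definition blk_mat ::
    "nat \<Rightarrow> nat \<Rightarrow> nat \<Rightarrow> nat \<Rightarrow> (nat \<Rightarrow> nat \<Rightarrow> nat \<Rightarrow> nat \<Rightarrow> 'a) \<Rightarrow> 'a mat" where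
  "blk_mat m n p q g =
     mat (m * p) (n * q) (\<lambda>(i, j). g (i div m) (j div n) (i mod m) (j mod n))"

lemma blk_mat_carrier [simp]: "blk_mat m n p q g \<in> carrier_mat (m * p) (n * q)"
  by (simp add: blk_mat_def)

lemma block_index_less:
  fixes a i m p :: nat
  assumes "a < p" "i < m"
  shows "a * m + i < m * p"
proof -
  have "a * m + i < Suc a * m" using assms by simp
  also have "\<dots> \<le> p * m" using assms by (intro mult_le_mono1) simp
  finally show ?thesis by (simp add: mult.commute)
qed

lemma block_div_mod_less:
  fixes i m p :: nat
  assumes "i < m * p"
  shows "i div m < p" "i mod m < m"
proof -
  have "0 < m" using assms by (cases m) auto
  then show "i mod m < m" "i div m < p" using assms by (auto simp: less_mult_imp_div_less mult.commute)
qed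

lemma blk_mat_index:
  assumes "a < p" "b < q" "i < m" "j < n"
  shows "blk_mat m n p q g $$ (a * m + i, b * n + j) = g a b i j"
  using assms by (simp add: blk_mat_def block_index_less)

lemma blk_mat_cong:
  assumes "\<And>a b i j. a < p \<Longrightarrow> b < q \<Longrightarrow> i < m \<Longrightarrow> j < n \<Longrightarrow> g a b i j = h a b i j"
  shows "blk_mat m n p q g = blk_mat m n p q h"
  unfolding blk_mat_def using assms block_div_mod_less by (intro cong_mat) auto

lemma blk_mat_inject:
  assumes "blk_mat m n p q g = blk_mat m n p q h" "a < p" "b < q" "i < m" "j < n"
  shows "g a b i j = h a b i j"
  using assms blk_mat_index by metis

text \<open>Division with remainder, \<open>x = b * n + j\<close>, cuts the range into
  \<open>q\<close> intervals of \<open>n\<close> consecutive indices.\<close>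

lemma sum_div_mod:
  fixes F :: "nat \<Rightarrow> nat \<Rightarrow> 'a::comm_monoid_add"
  shows "(\<Sum>x<n * q. F (x div n) (x mod n)) = (\<Sum>b<q. \<Sum>j<n. F b j)"
proof -
  have "(\<Sum>x<n * q. F (x div n) (x mod n)) =
      (\<Sum>b<q. \<Sum>x\<in>{b * n..<b * n + n}. F (x div n) (x mod n))"
    by (simp add: sum.nat_group mult.commute)
  also have "\<dots> = (\<Sum>b<q. \<Sum>j<n. F b j)"
  proof (rule sum.cong[OF refl])
    fix b
    have "(\<Sum>x\<in>{b * n..<b * n + n}. F (x div n) (x mod n)) =
        (\<Sum>j\<in>{0..<n}. F ((j + b * n) div n) ((j + b * n) mod n))"
      using sum.shift_bounds_nat_ivl[of "\<lambda>x. F (x div n) (x mod n)" 0 "b * n" n]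
      by (simp add: add.commute)
    also have "\<dots> = (\<Sum>j<n. F b j)" by (simp add: atLeast0LessThan)
    finally show "(\<Sum>x\<in>{b * n..<b * n + n}. F (x div n) (x mod n)) = (\<Sum>j<n. F b j)" .
  qed
  finally show ?thesis .
qed

lemma blk_mat_mult:
  fixes g h :: "nat \<Rightarrow> nat \<Rightarrow> nat \<Rightarrow> nat \<Rightarrow> 'a::semiring_0"
  shows "blk_mat m n p q g * blk_mat n s q r h =
    blk_mat m s p r (\<lambda>a c i k. \<Sum>b<q. \<Sum>j<n. g a b i j * h b c j k)"
proof (rule eq_matI)
  fix i k
  assume "i < dim_row (blk_mat m s p r (\<lambda>a c i k. \<Sum>b<q. \<Sum>j<n. g a b i j * h b c j k))"
    and "k < dim_col (blk_mat m s p r (\<lambda>a c i k. \<Sum>b<q. \<Sum>j<n. g a b i j * h b c j k))"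
  then have ik: "i < m * p" "k < s * r" by (auto simp: blk_mat_def)
  have "(blk_mat m n p q g * blk_mat n s q r h) $$ (i, k) =
      (\<Sum>x<n * q. g (i div m) (x div n) (i mod m) (x mod n) * h (x div n) (k div s) (x mod n) (k mod s))"
    using ik by (simp add: blk_mat_def scalar_prod_def atLeast0LessThan)
  also have "\<dots> = (\<Sum>b<q. \<Sum>j<n. g (i div m) b (i mod m) j * h b (k div s) j (k mod s))"
    by (rule sum_div_mod)
  finally show "(blk_mat m n p q g * blk_mat n s q r h) $$ (i, k) =
      blk_mat m s p r (\<lambda>a c i k. \<Sum>b<q. \<Sum>j<n. g a b i j * h b c j k) $$ (i, k)"
    using ik by (simp add: blk_mat_def)
qed (auto simp: blk_mat_def)

lemma blk_mat_adjoint: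
  "mat_adjoint (blk_mat m n p q g) = blk_mat n m q p (\<lambda>b a j i. conjugate (g a b i j))"
  by (rule eq_matI) (auto simp: blk_mat_def)

lemma blk_mat_transpose:
  "transpose_mat (blk_mat m n p q g) = blk_mat n m q p (\<lambda>b a j i. g a b i j)"
  by (rule eq_matI) (auto simp: blk_mat_def)

lemma blk_mat_one:
  "blk_mat n n p p (\<lambda>a b i j. if a = b then if i = j then 1 else 0 else 0) = 1\<^sub>m (n * p)"
proof (rule eq_matI)
  fix i j assume "i < dim_row (1\<^sub>m (n * p))" "j < dim_col (1\<^sub>m (n * p))"
  moreover have "i = j" if "i div n = j div n" "i mod n = j mod n"
    using that by (metis div_mult_mod_eq)
  ultimately show "blk_mat n n p p (\<lambda>a b i j. if a = b then if i = j then 1 else 0 else 0) $$ (i, j) =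
      1\<^sub>m (n * p) $$ (i, j)"
    by (auto simp: blk_mat_def)
qed (auto simp: blk_mat_def)

text \<open>Represents \<open>a - b\<close> modulo \<open>p\<close>: the subtraction does not truncate as long as \<open>b \<le> a + p\<close>.\<close>

abbreviation cdiff :: "nat \<Rightarrow> nat \<Rightarrow> nat \<Rightarrow> nat" where
  "cdiff p a b \<equiv> (a + p - b) mod p"

text \<open>In the integers the residue is that of an honest difference, so the usual congruence
  rules apply to it.\<close>

lemma int_cdiff:
  assumes "b \<le> p"
  shows "int (cdiff p a b) = (int a - int b) mod int p"
proof -
  have "int (a + p - b) = (int a - int b) + int p" using assms by simp
  then show ?thesis by (simp only: of_nat_mod mod_add_self2)
qed

text \<open>Differences modulo \<open>p\<close> are invariant under translation; this is what makes
  a product of block circulants block circulant again.\<close>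

lemma cdiff_cdiff:
  assumes "a < p" "b < p" "c < p"
  shows "cdiff p (cdiff p a c) (cdiff p b c) = cdiff p a b"
proof -
  have le: "b \<le> p" "c \<le> p" "cdiff p b c \<le> p" using assms by (auto intro: less_imp_le)
  have "int (cdiff p (cdiff p a c) (cdiff p b c)) = int (cdiff p a b)"
    unfolding int_cdiff[OF le(3)] int_cdiff[OF le(2)] int_cdiff[OF le(1)] by (simp add: mod_diff_eq)
  then show ?thesis by simp
qed

lemma cdiff_add:
  assumes "b < p" "c < p"
  shows "(cdiff p b c + c) mod p = b"
proof -
  have "int ((cdiff p b c + c) mod p) = (int (cdiff p b c) + int c) mod int p"
    by (simp only: of_nat_mod of_nat_add)
  also have "\<dots> = (int b - int c + int c) mod int p"
    unfolding int_cdiff[OF less_imp_le[OF assms(2)]] by (simp only: mod_add_left_eq)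
  finally have "int ((cdiff p b c + c) mod p) = int b" using assms by simp
  then show ?thesis by simp
qed

lemma cdiff_eq_0_iff:
  assumes "a < p" "b < p"
  shows "cdiff p a b = 0 \<longleftrightarrow> a = b"
  using cdiff_add[OF assms] assms by auto

text \<open>Subtracting \<open>c\<close> permutes the residues modulo \<open>p\<close>, with inverse
  the addition of \<open>c\<close>.\<close>

lemma sum_cdiff:
  fixes h :: "nat \<Rightarrow> 'a::comm_monoid_add"
  assumes c: "c < p"
  shows "(\<Sum>b<p. h (cdiff p b c)) = (\<Sum>b<p. h b)"
proof (rule sum.reindex_bij_witness[of _ "\<lambda>b. (b + c) mod p" "\<lambda>b. cdiff p b c"])
  fix b assume b: "b \<in> {..<p}"
  show "(cdiff p b c + c) mod p = b" using b c by (intro cdiff_add) auto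
  have "int (cdiff p ((b + c) mod p) c) = (int b + int c - int c) mod int p"
    unfolding int_cdiff[OF less_imp_le[OF c]] by (simp only: of_nat_mod of_nat_add mod_diff_left_eq)
  then have "int (cdiff p ((b + c) mod p) c) = int b" using b by simp
  then show "cdiff p ((b + c) mod p) c = b" by simp
qed (use c in auto)

section \<open>Block circulants of tensors, products and adjoints\<close>

definition tensor_of :: "nat \<Rightarrow> nat \<Rightarrow> nat \<Rightarrow> (nat \<Rightarrow> nat \<Rightarrow> nat \<Rightarrow> complex) \<Rightarrow> complex tensor" where
  "tensor_of m n p F = map (\<lambda>k. mat m n (\<lambda>(i, j). F k i j)) [0..<p]"

lemma tensor_of_carrier [simp]: "tensor_of m n p F \<in> carrier_tensor UNIV m n p"
  by (auto simp: tensor_of_def carrier_tensor_def)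

lemma tensor_of_nth [simp]: "k < p \<Longrightarrow> tensor_of m n p F ! k = mat m n (\<lambda>(i, j). F k i j)"
  by (simp add: tensor_of_def)

lemma carrier_tensorD:
  assumes "A \<in> carrier_tensor K m n p"
  shows "length A = p" "k < p \<Longrightarrow> A ! k \<in> carrier_mat m n"
    "k < p \<Longrightarrow> dim_row (A ! k) = m" "k < p \<Longrightarrow> dim_col (A ! k) = n"
    "0 < p \<Longrightarrow> slice_rows A = m" "0 < p \<Longrightarrow> slice_cols A = n"
    "k < p \<Longrightarrow> i < m \<Longrightarrow> j < n \<Longrightarrow> A ! k $$ (i, j) \<in> K"
proof -
  have car: "A ! k \<in> carrier_mat m n \<and> elements_mat (A ! k) \<subseteq> K" if "k < p" for k
    using assms that by (auto simp: carrier_tensor_def)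
  then show "k < p \<Longrightarrow> A ! k \<in> carrier_mat m n" by simp
  show l: "length A = p" using assms by (simp add: carrier_tensor_def)
  show "k < p \<Longrightarrow> dim_row (A ! k) = m" "k < p \<Longrightarrow> dim_col (A ! k) = n" using car by auto
  have "hd A = A ! 0" if "0 < p" using l that by (cases A) auto
  then show "0 < p \<Longrightarrow> slice_rows A = m" "0 < p \<Longrightarrow> slice_cols A = n" using car[of 0] by auto
  show "k < p \<Longrightarrow> i < m \<Longrightarrow> j < n \<Longrightarrow> A ! k $$ (i, j) \<in> K"
    using car[of k] elements_matI[of "A ! k" m n i j] by blast
qed

lemma carrier_tensor_UNIV: "A \<in> carrier_tensor K m n p \<Longrightarrow> A \<in> carrier_tensor UNIV m n p"
  by (auto simp: carrier_tensor_def)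

lemma bcirc_blk_mat:
  assumes "A \<in> carrier_tensor K m n p" "0 < p"
  shows "bcirc A = blk_mat m n p p (\<lambda>a b i j. A ! cdiff p a b $$ (i, j))"
  using carrier_tensorD[OF assms(1)] assms(2) by (simp add: bcirc_def blk_mat_def Let_def)

lemma bcirc_tensor_of:
  assumes "0 < p"
  shows "bcirc (tensor_of m n p F) = blk_mat m n p p (\<lambda>a b i j. F (cdiff p a b) i j)"
  by (subst bcirc_blk_mat[OF tensor_of_carrier assms]) (use assms in \<open>auto intro: blk_mat_cong\<close>)

lemma bcirc_carrier:
  assumes "A \<in> carrier_tensor K m n p" "0 < p"
  shows "bcirc A \<in> carrier_mat (m * p) (n * p)"
  unfolding bcirc_blk_mat[OF assms] by simp

lemma unfold_tensor_blk_mat: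
  assumes "A \<in> carrier_tensor K m n p" "0 < p"
  shows "unfold_tensor A = blk_mat m n p 1 (\<lambda>a b i j. A ! a $$ (i, j))"
  using carrier_tensorD[OF assms(1)] assms(2)
  by (auto simp: unfold_tensor_def blk_mat_def Let_def intro!: cong_mat)

lemma fold_tensor_blk_mat:
  assumes "0 < p"
  shows "fold_tensor p (blk_mat m n p 1 g) = tensor_of m n p (\<lambda>k. g k 0)"
proof (rule nth_equalityI)
  fix k assume "k < length (fold_tensor p (blk_mat m n p 1 g))"
  then have k: "k < p" by (simp add: fold_tensor_def Let_def)
  have [simp]: "dim_row (blk_mat m n p (Suc 0) g) = m * p" "dim_col (blk_mat m n p (Suc 0) g) = n"
    by (auto simp: blk_mat_def)
  have "blk_mat m n p 1 g $$ (k * m + i, j) = g k 0 i j" if "i < m" "j < n" for i j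
    using blk_mat_index[OF k, of 0 1 i m j n g] that by simp
  then show "fold_tensor p (blk_mat m n p 1 g) ! k = tensor_of m n p (\<lambda>k. g k 0) ! k"
    using k assms by (auto simp: fold_tensor_def Let_def intro!: cong_mat)
qed (simp add: fold_tensor_def tensor_of_def Let_def)

lemma tprod_eq:
  assumes A: "A \<in> carrier_tensor UNIV m n p" and B: "B \<in> carrier_tensor UNIV n s p" and p: "0 < p"
  shows "A *\<^sub>t B =
    tensor_of m s p (\<lambda>a i k. \<Sum>b<p. \<Sum>j<n. A ! cdiff p a b $$ (i, j) * B ! b $$ (j, k))"
  by (simp add: tprod_def carrier_tensorD(1)[OF A] bcirc_blk_mat[OF A p] unfold_tensor_blk_mat[OF B p]
      blk_mat_mult fold_tensor_blk_mat[OF p] del: One_nat_def)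

lemma tprod_carrier:
  assumes A: "A \<in> carrier_tensor UNIV m n p" and B: "B \<in> carrier_tensor UNIV n s p" and p: "0 < p"
  shows "A *\<^sub>t B \<in> carrier_tensor UNIV m s p"
  unfolding tprod_eq[OF assms] by simp

text \<open>The T-product describes only the first block column of the product. Shifting the
  summation index by the column number \<open>c\<close> gives the other columns, since both factors
  depend only on index differences.\<close>

lemma bcirc_tprod:
  assumes A: "A \<in> carrier_tensor UNIV m n p" and B: "B \<in> carrier_tensor UNIV n s p" and p: "0 < p"
  shows "bcirc (A *\<^sub>t B) = bcirc A * bcirc B"
  unfolding tprod_eq[OF assms] bcirc_tensor_of[OF p] bcirc_blk_mat[OF A p] bcirc_blk_mat[OF B p]
    blk_mat_mult
proof (rule blk_mat_cong)
  fix a c i k assume ac: "a < p" "c < p"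
  define h where "h b = (\<Sum>j<n. A ! cdiff p (cdiff p a c) b $$ (i, j) * B ! b $$ (j, k))" for b
  have "(\<Sum>b<p. h b) = (\<Sum>b<p. h (cdiff p b c))" by (rule sum_cdiff[OF ac(2), symmetric])
  also have "\<dots> = (\<Sum>b<p. \<Sum>j<n. A ! cdiff p a b $$ (i, j) * B ! cdiff p b c $$ (j, k))"
    unfolding h_def using ac by (intro sum.cong refl) (simp only: cdiff_cdiff lessThan_iff)
  finally show "(\<Sum>b<p. \<Sum>j<n. A ! cdiff p (cdiff p a c) b $$ (i, j) * B ! b $$ (j, k)) =
    (\<Sum>b<p. \<Sum>j<n. A ! cdiff p a b $$ (i, j) * B ! cdiff p b c $$ (j, k))"
    unfolding h_def .
qed

text \<open>Keeping the first slice and reversing the others is the negation of slice indices modulo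
  their number; the outer \<open>mod\<close> sends index 0 to itself.\<close>

lemma nth_map_reverse_tail:
  assumes "k < length xs"
  shows "map f (take 1 xs @ rev (drop 1 xs)) ! k = f (xs ! ((length xs - k) mod length xs))"
proof (cases k)
  case 0
  then show ?thesis using assms by (cases xs) auto
next
  case (Suc l)
  then have "(take 1 xs @ rev (drop 1 xs)) ! k = xs ! (length xs - k)"
    using assms by (cases xs) (auto simp: rev_nth)
  moreover have "k < length (take 1 xs @ rev (drop 1 xs))" using assms by simp
  ultimately show ?thesis using assms Suc by (simp del: map_append)
qed

lemma cdiff_neg:
  assumes "a < p" "b < p"
  shows "(p - cdiff p a b) mod p = cdiff p b a"
  using cdiff_cdiff[of b p a b] assms by simp

lemma adjoint_tensor_carrier:
  assumes "A \<in> carrier_tensor UNIV m n p"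
  shows "adjoint_tensor A \<in> carrier_tensor UNIV n m p"
  using assms by (cases A) (auto simp: adjoint_tensor_def carrier_tensor_def)

lemma transpose_tensor_carrier:
  assumes "A \<in> carrier_tensor UNIV m n p"
  shows "transpose_tensor A \<in> carrier_tensor UNIV n m p"
  using assms by (cases A) (auto simp: transpose_tensor_def carrier_tensor_def)

text \<open>Negating the residue of \<open>a - b\<close> exchanges \<open>a\<close> and
  \<open>b\<close>. The reversal of the slices thus transposes the block pattern, while the adjoints
  of the slices treat the blocks themselves.\<close>

lemma bcirc_adjoint:
  assumes A: "A \<in> carrier_tensor UNIV m n p" and p: "0 < p"
  shows "bcirc (adjoint_tensor A) = mat_adjoint (bcirc A)"
proof -
  have "adjoint_tensor A ! k = mat_adjoint (A ! ((p - k) mod p))" if "k < p" for k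
    using that carrier_tensorD(1)[OF A] nth_map_reverse_tail[of k A mat_adjoint]
    by (simp only: adjoint_tensor_def)
  then show ?thesis
    unfolding bcirc_blk_mat[OF A p] bcirc_blk_mat[OF adjoint_tensor_carrier[OF A] p] blk_mat_adjoint
    using p carrier_tensorD(3,4)[OF A] by (intro blk_mat_cong) (simp add: cdiff_neg)
qed

lemma bcirc_transpose:
  assumes A: "A \<in> carrier_tensor UNIV m n p" and p: "0 < p"
  shows "bcirc (transpose_tensor A) = transpose_mat (bcirc A)"
proof -
  have "transpose_tensor A ! k = transpose_mat (A ! ((p - k) mod p))" if "k < p" for k
    using that carrier_tensorD(1)[OF A] nth_map_reverse_tail[of k A transpose_mat]
    by (simp only: transpose_tensor_def)
  then show ?thesis
    unfolding bcirc_blk_mat[OF A p] bcirc_blk_mat[OF transpose_tensor_carrier[OF A] p] blk_mat_transpose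
    using p carrier_tensorD(3,4)[OF A] by (intro blk_mat_cong) (simp add: cdiff_neg)
qed

section \<open>Tensors concentrated in the first slice\<close>

lemma nth_first_slice_tensor:
  "k < p \<Longrightarrow> first_slice_tensor p M ! k = (if k = 0 then M else 0\<^sub>m (dim_row M) (dim_col M))"
  by (cases k) (auto simp: first_slice_tensor_def)

lemma first_slice_tensor_carrier:
  assumes "M \<in> carrier_mat m n" "0 < p"
  shows "first_slice_tensor p M \<in> carrier_tensor UNIV m n p"
  using assms by (auto simp: first_slice_tensor_def carrier_tensor_def)

text \<open>The first slice is selected exactly where \<open>a - b\<close> has residue 0, so the
  block circulant is block diagonal with constant block.\<close>

lemma bcirc_first_slice_tensor:
  assumes M: "M \<in> carrier_mat m n" and p: "0 < p"
  shows "bcirc (first_slice_tensor p M) = blk_mat m n p p (\<lambda>a b i j. if a = b then M $$ (i, j) else 0)"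
  unfolding bcirc_blk_mat[OF first_slice_tensor_carrier[OF assms] p]
  using p carrier_matD[OF M] by (intro blk_mat_cong) (simp add: nth_first_slice_tensor cdiff_eq_0_iff)

lemma bcirc_first_slice_tensor_mult:
  assumes M: "M \<in> carrier_mat m n" and N: "N \<in> carrier_mat n s" and p: "0 < p"
  shows "bcirc (first_slice_tensor p M) * bcirc (first_slice_tensor p N) =
    bcirc (first_slice_tensor p (M * N))"
  unfolding bcirc_first_slice_tensor[OF M p] bcirc_first_slice_tensor[OF N p]
    bcirc_first_slice_tensor[OF mult_carrier_mat[OF M N] p] blk_mat_mult
proof (rule blk_mat_cong)
  fix a b i j assume *: "a < p" "b < p" "i < m" "j < s"
  have "(\<Sum>c<p. \<Sum>k<n. (if a = c then M $$ (i, k) else 0) * (if c = b then N $$ (k, j) else 0)) =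
    (\<Sum>c<p. if a = c then (if a = b then \<Sum>k<n. M $$ (i, k) * N $$ (k, j) else 0) else 0)"
    by (intro sum.cong) auto
  also have "\<dots> = (if a = b then \<Sum>k<n. M $$ (i, k) * N $$ (k, j) else 0)" using * by simp
  also have "(\<Sum>k<n. M $$ (i, k) * N $$ (k, j)) = (M * N) $$ (i, j)"
    using * M N by (auto simp: scalar_prod_def atLeast0LessThan intro!: sum.cong)
  finally show "(\<Sum>c<p. \<Sum>k<n. (if a = c then M $$ (i, k) else 0) * (if c = b then N $$ (k, j) else 0)) =
    (if a = b then (M * N) $$ (i, j) else 0)" .
qed

lemma id_tensor_carrier: "0 < p \<Longrightarrow> id_tensor n p \<in> carrier_tensor UNIV n n p"
  unfolding id_tensor_def by (rule first_slice_tensor_carrier) auto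

lemma bcirc_id_tensor:
  assumes "0 < p"
  shows "bcirc (id_tensor n p) = 1\<^sub>m (n * p)"
proof -
  have "bcirc (id_tensor n p) = blk_mat n n p p (\<lambda>a b i j. if a = b then if i = j then 1 else 0 else 0)"
    unfolding id_tensor_def bcirc_first_slice_tensor[OF one_carrier_mat assms]
    by (intro blk_mat_cong) auto
  then show ?thesis by (simp add: blk_mat_one)
qed

section \<open>Inverses and unitarity read off from block circulants\<close>

lemma bcirc_inject:
  assumes "A \<in> carrier_tensor UNIV m n p" "B \<in> carrier_tensor UNIV m n p" "0 < p"
    and "bcirc A = bcirc B"
  shows "A = B"
  using inj_onD[OF inj_on_bcirc[OF assms(3)] assms(4,1,2)] .

lemma tprod_eq_id_iff:
  assumes "A \<in> carrier_tensor UNIV n n p" "B \<in> carrier_tensor UNIV n n p" "0 < p"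
  shows "A *\<^sub>t B = id_tensor n p \<longleftrightarrow> bcirc A * bcirc B = 1\<^sub>m (n * p)"
  using bcirc_inject[OF tprod_carrier[OF assms] id_tensor_carrier[OF assms(3)] assms(3)]
  by (metis assms bcirc_id_tensor bcirc_tprod)

text \<open>Block circulants of square slices are square, so the second product equation follows
  from the first.\<close>

lemma inverse_tensor_of_iff:
  assumes A: "A \<in> carrier_tensor UNIV n n p" and p: "0 < p"
  shows "inverse_tensor_of A B \<longleftrightarrow>
    B \<in> carrier_tensor UNIV n n p \<and> bcirc A * bcirc B = 1\<^sub>m (n * p)"
proof -
  have "bcirc B * bcirc A = 1\<^sub>m (n * p)"
    if "B \<in> carrier_tensor UNIV n n p" "bcirc A * bcirc B = 1\<^sub>m (n * p)"
    using mat_mult_left_right_inverse[OF bcirc_carrier[OF A p] bcirc_carrier[OF that(1) p] that(2)] .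
  then show ?thesis
    using carrier_tensorD[OF A] A p by (auto simp: inverse_tensor_of_def Let_def tprod_eq_id_iff)
qed

text \<open>Inverses of matrices are unique and \<open>bcirc\<close> is injective, so the definite
  description in \<open>inv_tensor\<close> denotes any inverse that has been found.\<close>

lemma inv_tensor_eq:
  assumes A: "A \<in> carrier_tensor UNIV n n p" and B: "B \<in> carrier_tensor UNIV n n p" and p: "0 < p"
    and AB: "bcirc A * bcirc B = 1\<^sub>m (n * p)"
  shows "inv_tensor A = B"
  unfolding inv_tensor_def
proof (rule the_equality)
  show "inverse_tensor_of A B" using inverse_tensor_of_iff[OF A p] B AB by simp
next
  fix C assume "inverse_tensor_of A C"
  then have C: "C \<in> carrier_tensor UNIV n n p" "bcirc A * bcirc C = 1\<^sub>m (n * p)"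
    using inverse_tensor_of_iff[OF A p] by auto
  note c = bcirc_carrier[OF A p] bcirc_carrier[OF B p] bcirc_carrier[OF C(1) p]
  have "bcirc B * bcirc A = 1\<^sub>m (n * p)" by (rule mat_mult_left_right_inverse[OF c(1,2) AB])
  then have "bcirc C = bcirc B * (bcirc A * bcirc C)"
    using mult_cancel_left_inverse c by metis
  then have "bcirc C = bcirc B" using C(2) c by simp
  then show "C = B" by (rule bcirc_inject[OF C(1) B p])
qed

lemma unitary_tensor_iff:
  assumes p: "0 < p"
  shows "unitary_tensor n p Q \<longleftrightarrow> Q \<in> carrier_tensor UNIV n n p \<and> unitary_mat (n * p) (bcirc Q)"
proof (cases "Q \<in> carrier_tensor UNIV n n p")
  case True
  then show ?thesis
    using p by (simp add: unitary_tensor_def unitary_mat_def tprod_eq_id_iff adjoint_tensor_carrier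
        bcirc_adjoint bcirc_carrier)
qed (simp add: unitary_tensor_def)

section \<open>The discrete Fourier transform of a tensor\<close>

definition dft_root :: "nat \<Rightarrow> complex" where
  "dft_root p = exp (- 2 * of_real pi * \<i> / of_nat p)"

lemma dft_root_cis: "dft_root p = cis (- (2 * pi / real p))"
  by (simp add: dft_root_def cis_conv_exp field_simps)

lemma dft_root_power_cnj: "dft_root p ^ k * cnj (dft_root p ^ k) = 1"
  by (simp add: dft_root_cis DeMoivre cis_cnj cis_mult)

lemma dft_root_power_order: "0 < p \<Longrightarrow> dft_root p ^ p = 1"
  by (simp add: dft_root_cis DeMoivre complex_eq_iff)

lemma dft_root_power_mod: "0 < p \<Longrightarrow> dft_root p ^ (k mod p) = dft_root p ^ k"
  by (metis dft_root_power_order div_mult_mod_eq mult_1 power_add power_mult power_one mult.commute)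

lemma dft_root_power_ne_1:
  assumes "0 < k" "k < p"
  shows "dft_root p ^ k \<noteq> 1"
proof
  assume "dft_root p ^ k = 1"
  \<comment> \<open>The known parametrisation of the roots of unity runs through positive angles,
    whereas \<open>dft_root\<close> has a negative one; conjugation switches between them.\<close>
  then have "cnj (dft_root p ^ k) = cnj 1" by simp
  then have eq: "cis (2 * pi * real k / real p) = cis (2 * pi * real 0 / real p)"
    by (simp add: dft_root_cis DeMoivre cis_cnj mult_ac)
  have inj: "inj_on (\<lambda>k. cis (2 * pi * real k / real p)) {..<p}"
    using bij_betw_roots_unity[of p] assms by (auto simp: bij_betw_def)
  have "k = 0" by (rule inj_onD[OF inj eq]) (use assms in auto)
  then show False using assms by simp
qed

text \<open>For \<open>k\<close> other than 0 this is a geometric sum with ratio different from 1,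
  and its numerator vanishes because the \<open>p\<close>-th power of the root is 1.\<close>

lemma sum_dft_root_power:
  assumes "k < p"
  shows "(\<Sum>c<p. dft_root p ^ (k * c)) = (if k = 0 then of_nat p else 0)"
proof (cases "k = 0")
  case False
  have "(\<Sum>c<p. (dft_root p ^ k) ^ c) = ((dft_root p ^ k) ^ p - 1) / (dft_root p ^ k - 1)"
    using False assms by (intro geometric_sum dft_root_power_ne_1) auto
  also have "(dft_root p ^ k) ^ p = 1"
    using assms by (metis dft_root_power_order mult.commute not_less0 gr0I power_mult power_one)
  finally show ?thesis using False by (simp add: power_mult)
qed simp

text \<open>Conjugation inverts powers of the root, and exponents matter only modulo
  \<open>p\<close>. The dependence on \<open>a - b\<close> alone is the reason why conjugating a
  block diagonal matrix with Fourier matrices produces a block circulant.\<close>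

lemma dft_root_cdiff:
  assumes "b < p"
  shows "dft_root p ^ (a * c) * cnj (dft_root p ^ (b * c)) = dft_root p ^ (cdiff p a b * c)"
proof -
  have "dft_root p ^ (a + p - b) * dft_root p ^ b = dft_root p ^ a * dft_root p ^ p"
    using assms by (simp flip: power_add)
  then have "dft_root p ^ (a + p - b) * (dft_root p ^ b * cnj (dft_root p ^ b)) =
      dft_root p ^ a * dft_root p ^ p * cnj (dft_root p ^ b)"
    by (metis mult.assoc)
  then have "dft_root p ^ cdiff p a b = dft_root p ^ a * cnj (dft_root p ^ b)"
    using assms dft_root_power_order[of p] dft_root_power_mod[of p] by (simp only: dft_root_power_cnj) simp
  then show ?thesis by (simp add: power_mult power_mult_distrib)
qed

section \<open>The Fourier matrix acting on blocks\<close>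

definition fourier_mat :: "nat \<Rightarrow> nat \<Rightarrow> complex mat" where
  "fourier_mat n p = kronecker_mat (dft_mat p) (1\<^sub>m n)"

lemma kronecker_mat_one:
  fixes A :: "complex mat"
  assumes "A \<in> carrier_mat p q"
  shows "kronecker_mat A (1\<^sub>m n) = blk_mat n n p q (\<lambda>a b i j. A $$ (a, b) * (if i = j then 1 else 0))"
proof (rule eq_matI)
  fix i j
  assume "i < dim_row (blk_mat n n p q (\<lambda>a b i j. A $$ (a, b) * (if i = j then 1 else 0)))"
    and "j < dim_col (blk_mat n n p q (\<lambda>a b i j. A $$ (a, b) * (if i = j then 1 else 0)))"
  then have ij: "i < n * p" "j < n * q" by (auto simp: blk_mat_def)
  then show "kronecker_mat A (1\<^sub>m n) $$ (i, j) =
      blk_mat n n p q (\<lambda>a b i j. A $$ (a, b) * (if i = j then 1 else 0)) $$ (i, j)"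
    using assms block_div_mod_less[OF ij(1)] block_div_mod_less[OF ij(2)]
    by (auto simp: kronecker_mat_def blk_mat_def mult.commute)
qed (use assms in \<open>auto simp: kronecker_mat_def blk_mat_def mult.commute\<close>)

lemma dft_mat_carrier [simp]: "dft_mat p \<in> carrier_mat p p"
  by (simp add: dft_mat_def)

lemma dft_mat_index:
  "a < p \<Longrightarrow> b < p \<Longrightarrow> dft_mat p $$ (a, b) = dft_root p ^ (a * b) / of_real (sqrt (real p))"
  by (simp add: dft_mat_def dft_root_def)

lemma fourier_mat_blk:
  "fourier_mat n p = blk_mat n n p p (\<lambda>a b i j. dft_mat p $$ (a, b) * (if i = j then 1 else 0))"
  unfolding fourier_mat_def by (rule kronecker_mat_one) simp

lemma fourier_mat_carrier [simp]: "fourier_mat n p \<in> carrier_mat (n * p) (n * p)"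
  by (simp add: fourier_mat_blk)

lemma kronecker_adjoint_dft:
  "kronecker_mat (mat_adjoint (dft_mat p)) (1\<^sub>m n) = mat_adjoint (fourier_mat n p)"
proof -
  have "mat_adjoint (dft_mat p) \<in> carrier_mat p p" by simp
  then show ?thesis
    unfolding fourier_mat_blk blk_mat_adjoint kronecker_mat_one[OF \<open>mat_adjoint (dft_mat p) \<in> carrier_mat p p\<close>]
    using carrier_matD[OF dft_mat_carrier] by (intro blk_mat_cong) auto
qed

section \<open>Block diagonal matrices and the passage from Fourier blocks to slices\<close>

definition blk_diag :: "nat \<Rightarrow> nat \<Rightarrow> nat \<Rightarrow> (nat \<Rightarrow> nat \<Rightarrow> nat \<Rightarrow> complex) \<Rightarrow> complex mat" where
  "blk_diag m n p C = blk_mat m n p p (\<lambda>a b i j. if a = b then C a i j else 0)"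

lemma blk_diag_carrier [simp]: "blk_diag m n p C \<in> carrier_mat (m * p) (n * p)"
  by (simp add: blk_diag_def)

lemma blk_diag_cong:
  "(\<And>a i j. a < p \<Longrightarrow> i < m \<Longrightarrow> j < n \<Longrightarrow> C a i j = D a i j) \<Longrightarrow> blk_diag m n p C = blk_diag m n p D"
  unfolding blk_diag_def by (intro blk_mat_cong) auto

lemma blk_diag_mult:
  "blk_diag m n p C * blk_diag n s p D = blk_diag m s p (\<lambda>a i k. \<Sum>j<n. C a i j * D a j k)"
  unfolding blk_diag_def blk_mat_mult
proof (rule blk_mat_cong)
  fix a b i j assume *: "a < p" "b < p" "i < m" "j < s"
  have "(\<Sum>c<p. \<Sum>k<n. (if a = c then C a i k else 0) * (if c = b then D c k j else 0)) =
    (\<Sum>c<p. if a = c then (if a = b then \<Sum>k<n. C a i k * D a k j else 0) else 0)"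
    by (intro sum.cong) auto
  then show "(\<Sum>c<p. \<Sum>k<n. (if a = c then C a i k else 0) * (if c = b then D c k j else 0)) =
    (if a = b then \<Sum>k<n. C a i k * D a k j else 0)" using * by simp
qed

lemma blk_diag_adjoint: "mat_adjoint (blk_diag m n p C) = blk_diag n m p (\<lambda>a j i. cnj (C a i j))"
  unfolding blk_diag_def blk_mat_adjoint by (intro blk_mat_cong) auto

lemma blk_diag_one: "blk_diag n n p (\<lambda>a i j. if i = j then 1 else 0) = 1\<^sub>m (n * p)"
  unfolding blk_diag_def by (rule blk_mat_one)

text \<open>Connects the recursive construction from a list of blocks with the closed entry formula;
  equal block sizes make division and remainder locate the block.\<close>

lemma diag_block_mat_eq_blk_diag:
  assumes "length Cs = p" and "\<And>C. C \<in> set Cs \<Longrightarrow> C \<in> carrier_mat m n"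
  shows "diag_block_mat Cs = blk_diag m n p (\<lambda>a i j. Cs ! a $$ (i, j))"
  using assms
proof (induction Cs arbitrary: p)
  case Nil
  then show ?case by (intro eq_matI) (auto simp: blk_diag_def blk_mat_def)
next
  case (Cons C Cs)
  define q where "q = length Cs"
  have C: "C \<in> carrier_mat m n" and p: "p = Suc q" using Cons.prems by (auto simp: q_def)
  have IH: "diag_block_mat Cs = blk_diag m n q (\<lambda>a i j. Cs ! a $$ (i, j))"
    using Cons.prems by (intro Cons.IH) (auto simp: q_def)
  show ?case
  proof (rule eq_matI)
    fix i j
    assume "i < dim_row (blk_diag m n p (\<lambda>a i j. (C # Cs) ! a $$ (i, j)))"
      and "j < dim_col (blk_diag m n p (\<lambda>a i j. (C # Cs) ! a $$ (i, j)))"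
    then have ij: "i < m + m * q" "j < n + n * q" by (auto simp: blk_diag_def blk_mat_def p)
    then have mn: "0 < m" "0 < n" by (auto intro: gr0I)
    \<comment> \<open>Removing the leading block lowers the block number by one and keeps the
      position inside the block.\<close>
    have div: "x div k = Suc ((x - k) div k)" "x mod k = (x - k) mod k"
      if "k \<le> x" "0 < k" for x k :: nat
      using that by (simp_all add: le_div_geq le_mod_geq)
    show "diag_block_mat (C # Cs) $$ (i, j) = blk_diag m n p (\<lambda>a i j. (C # Cs) ! a $$ (i, j)) $$ (i, j)"
      unfolding diag_block_mat.simps IH Let_def using C ij mn
      by (cases "i < m"; cases "j < n") (auto simp: blk_diag_def blk_mat_def p div not_less)
  qed (use C in \<open>auto simp: IH Let_def blk_diag_def blk_mat_def p\<close>)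
qed

text \<open>The tensor whose Fourier blocks are \<open>C 0\<close>, ..., \<open>C (p - 1)\<close>.
  The exponent carries no conjugate since the diagonal form is \<open>F * D * mat_adjoint F\<close>,
  and the divisor \<open>p\<close> collects the two normalisations of \<open>F\<close>.\<close>

definition inv_dft_tensor ::
    "nat \<Rightarrow> nat \<Rightarrow> nat \<Rightarrow> (nat \<Rightarrow> nat \<Rightarrow> nat \<Rightarrow> complex) \<Rightarrow> complex tensor" where
  "inv_dft_tensor m n p C =
     tensor_of m n p (\<lambda>k i j. (\<Sum>c<p. dft_root p ^ (k * c) * C c i j) / of_nat p)"

lemma inv_dft_tensor_carrier [simp]: "inv_dft_tensor m n p C \<in> carrier_tensor UNIV m n p"
  by (simp add: inv_dft_tensor_def)

text \<open>Block \<open>(a, b)\<close> of the right side is the sum over \<open>c\<close> of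
  \<open>C c\<close>, weighted by the Fourier entry at \<open>(a, c)\<close> and the conjugate of
  the one at \<open>(b, c)\<close>. By \<open>dft_root_cdiff\<close> these weights depend only on
  \<open>a - b\<close>, as in a circulant.\<close>

lemma bcirc_inv_dft_tensor:
  assumes p: "0 < p"
  shows "bcirc (inv_dft_tensor m n p C) = fourier_mat m p * blk_diag m n p C * mat_adjoint (fourier_mat n p)"
proof -
  have 1: "fourier_mat m p * blk_diag m n p C =
      blk_mat m n p p (\<lambda>a c i k. dft_mat p $$ (a, c) * C c i k)"
    unfolding fourier_mat_blk blk_diag_def blk_mat_mult
  proof (rule blk_mat_cong)
    fix a c i k assume *: "a < p" "c < p" "i < m" "k < n"
    have "(\<Sum>b<p. \<Sum>j<m. dft_mat p $$ (a, b) * (if i = j then 1 else 0) * (if b = c then C b j k else 0)) =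
      (\<Sum>b<p. \<Sum>j<m. if i = j then if b = c then dft_mat p $$ (a, c) * C c i k else 0 else 0)"
      by (intro sum.cong refl) auto
    then show "(\<Sum>b<p. \<Sum>j<m. dft_mat p $$ (a, b) * (if i = j then 1 else 0) * (if b = c then C b j k else 0)) =
      dft_mat p $$ (a, c) * C c i k" using * by simp
  qed
  show ?thesis
    unfolding inv_dft_tensor_def bcirc_tensor_of[OF p] 1
    unfolding fourier_mat_blk blk_mat_adjoint blk_mat_mult
  proof (rule blk_mat_cong)
    fix a b i k assume *: "a < p" "b < p" "i < m" "k < n"
    have "(\<Sum>c<p. \<Sum>j<n. dft_mat p $$ (a, c) * C c i j *
          conjugate (dft_mat p $$ (b, c) * (if k = j then 1 else 0))) =
        (\<Sum>c<p. \<Sum>j<n. if k = j then dft_mat p $$ (a, c) * C c i k * cnj (dft_mat p $$ (b, c)) else 0)"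
      by (intro sum.cong) auto
    also have "\<dots> = (\<Sum>c<p. dft_mat p $$ (a, c) * cnj (dft_mat p $$ (b, c)) * C c i k)"
      using * by (intro sum.cong) auto
    also have "\<dots> = (\<Sum>c<p. dft_root p ^ (cdiff p a b * c) * C c i k / of_nat p)"
    proof (intro sum.cong refl)
      fix c assume "c \<in> {..<p}"
      then have c: "c < p" by simp
      have "complex_of_real (sqrt (real p)) * of_real (sqrt (real p)) = of_nat p"
        by (simp flip: of_real_mult)
      then have "dft_mat p $$ (a, c) * cnj (dft_mat p $$ (b, c)) =
          dft_root p ^ (a * c) * cnj (dft_root p ^ (b * c)) / of_nat p"
        using * c by (simp add: dft_mat_index)
      then show "dft_mat p $$ (a, c) * cnj (dft_mat p $$ (b, c)) * C c i k =
          dft_root p ^ (cdiff p a b * c) * C c i k / of_nat p"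
        unfolding dft_root_cdiff[OF *(2)] by simp
    qed
    finally show "(\<Sum>c<p. dft_root p ^ (cdiff p a b * c) * C c i k) / of_nat p =
        (\<Sum>c<p. \<Sum>j<n. dft_mat p $$ (a, c) * C c i j *
          conjugate (dft_mat p $$ (b, c) * (if k = j then 1 else 0)))"
      by (simp add: sum_divide_distrib)
  qed
qed

text \<open>With identity matrices as Fourier blocks, the formula for \<open>inv_dft_tensor\<close>
  computes the product of the Fourier matrix with its adjoint, and the sums of roots of unity vanish
  off the diagonal.\<close>

lemma unitary_fourier_mat:
  assumes p: "0 < p"
  shows "unitary_mat (n * p) (fourier_mat n p)"
proof -
  have "fourier_mat n p * mat_adjoint (fourier_mat n p) =
      bcirc (inv_dft_tensor n n p (\<lambda>a i j. if i = j then 1 else 0))"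
    unfolding bcirc_inv_dft_tensor[OF p] blk_diag_one
    by (simp add: right_mult_one_mat[of _ "n * p" "n * p"])
  also have "\<dots> = blk_mat n n p p (\<lambda>a b i j. if a = b then if i = j then 1 else 0 else 0)"
    unfolding inv_dft_tensor_def bcirc_tensor_of[OF p]
  proof (rule blk_mat_cong)
    fix a b i j assume *: "a < p" "b < p"
    have "(\<Sum>c<p. dft_root p ^ (cdiff p a b * c) * (if i = j then 1 else 0)) =
        (if i = j then \<Sum>c<p. dft_root p ^ (cdiff p a b * c) else 0)" by simp
    then show "(\<Sum>c<p. dft_root p ^ (cdiff p a b * c) * (if i = j then 1 else 0)) / of_nat p =
        (if a = b then if i = j then 1 else 0 else 0)"
      using p * by (simp add: sum_dft_root_power cdiff_eq_0_iff)
  qed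
  finally have "fourier_mat n p * mat_adjoint (fourier_mat n p) = 1\<^sub>m (n * p)"
    by (simp add: blk_mat_one)
  then show ?thesis
    using unitary_matI[of "mat_adjoint (fourier_mat n p)" "n * p"] unitary_mat_adjoint by fastforce
qed

lemma inv_dft_tensor_surj:
  assumes A: "A \<in> carrier_tensor UNIV m n p" and p: "0 < p"
  obtains C where "A = inv_dft_tensor m n p C"
proof
  \<comment> \<open>The forward transform, with the conjugate roots; its inversion rests on the
    orthogonality of the roots of unity.\<close>
  define C where "C c i j = (\<Sum>b<p. cnj (dft_root p ^ (b * c)) * A ! b $$ (i, j))" for c i j
  show "A = inv_dft_tensor m n p C"
  proof (rule nth_equalityI)
    fix k assume "k < length A"
    then have k: "k < p" using carrier_tensorD(1)[OF A] by simp
    have "(\<Sum>c<p. dft_root p ^ (k * c) * C c i j) / of_nat p = A ! k $$ (i, j)" for i j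
    proof -
      have "(\<Sum>c<p. dft_root p ^ (k * c) * C c i j) =
          (\<Sum>c<p. \<Sum>b<p. dft_root p ^ (cdiff p k b * c) * A ! b $$ (i, j))"
        by (intro sum.cong refl) (simp add: C_def sum_distrib_left mult.assoc[symmetric] dft_root_cdiff
            del: complex_cnj_power)
      also have "\<dots> = (\<Sum>b<p. (\<Sum>c<p. dft_root p ^ (cdiff p k b * c)) * A ! b $$ (i, j))"
        unfolding sum_distrib_right by (rule sum.swap)
      \<comment> \<open>The inner sum of roots vanishes unless \<open>k - b\<close> has residue
        0.\<close>
      also have "\<dots> = (\<Sum>b<p. if k = b then of_nat p * A ! b $$ (i, j) else 0)"
        using k p by (intro sum.cong refl) (simp add: sum_dft_root_power cdiff_eq_0_iff)
      also have "\<dots> = of_nat p * A ! k $$ (i, j)" using k by simp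
      finally show ?thesis using p by simp
    qed
    then show "A ! k = inv_dft_tensor m n p C ! k"
      using k carrier_tensorD(3,4)[OF A] by (intro eq_matI) (auto simp: inv_dft_tensor_def)
  qed (use carrier_tensorD(1)[OF A] in \<open>simp add: inv_dft_tensor_def tensor_of_def\<close>)
qed

section \<open>The generalized tensor function of an invertible tensor\<close>

text \<open>Besides rewriting the Fourier form of a T-SVD, this exhibits it as a value of
  \<open>bcirc\<close>, which is required before \<open>bcirc_inv\<close> can be evaluated on
  it.\<close>

lemma fourier_blocks_eq:
  assumes "0 < p" "length Ds = p" "\<And>D. D \<in> set Ds \<Longrightarrow> D \<in> carrier_mat m n"
  shows "fourier_blocks m n p Ds = bcirc (inv_dft_tensor m n p (\<lambda>a i j. of_real (Ds ! a $$ (i, j))))"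
proof -
  have D: "Ds ! a \<in> carrier_mat m n" if "a < p" for a using assms(2,3) that by auto
  have "diag_block_mat (map (map_mat complex_of_real) Ds) =
      blk_diag m n p (\<lambda>a i j. map (map_mat complex_of_real) Ds ! a $$ (i, j))"
    using assms by (intro diag_block_mat_eq_blk_diag) auto
  also have "\<dots> = blk_diag m n p (\<lambda>a i j. of_real (Ds ! a $$ (i, j)))"
    using D assms(2) by (intro blk_diag_cong) (simp add: carrier_matD[OF D])
  finally show ?thesis
    unfolding fourier_blocks_def kronecker_adjoint_dft bcirc_inv_dft_tensor[OF assms(1)]
    by (simp add: fourier_mat_def)
qed

lemma bcirc_inv_bcirc:
  assumes "A \<in> carrier_tensor UNIV m n p" "0 < p"
  shows "bcirc_inv m n p (bcirc A) = A"
  unfolding bcirc_inv_def using inj_on_bcirc[OF assms(2)] assms(1) by (rule inv_into_f_f)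

lemma blk_diag_real_diag:
  assumes "\<And>a i j. a < p \<Longrightarrow> i < n \<Longrightarrow> j < n \<Longrightarrow> C a i j = (if i = j then of_real (d (a * n + i)) else 0)"
  shows "blk_diag n n p C = real_diag (n * p) d"
proof (rule eq_matI)
  fix i j assume "i < dim_row (real_diag (n * p) d)" "j < dim_col (real_diag (n * p) d)"
  then have ij: "i < n * p" "j < n * p" by (auto simp: real_diag_def)
  have "i = j" if "i div n = j div n" "i mod n = j mod n"
    using that by (metis div_mult_mod_eq)
  then show "blk_diag n n p C $$ (i, j) = real_diag (n * p) d $$ (i, j)"
    using ij block_div_mod_less[OF ij(1)] block_div_mod_less[OF ij(2)]
    by (auto simp: blk_diag_def blk_mat_def real_diag_def assms)
qed (auto simp: blk_diag_def blk_mat_def real_diag_def)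

text \<open>The inner Fourier factors cancel by unitarity, which leaves the product of the Fourier
  blocks.\<close>

lemma bcirc_inv_dft_mult:
  assumes p: "0 < p"
  shows "bcirc (inv_dft_tensor n n p C) * bcirc (inv_dft_tensor n n p D) =
    bcirc (inv_dft_tensor n n p (\<lambda>a i k. \<Sum>j<n. C a i j * D a j k))"
  unfolding bcirc_inv_dft_tensor[OF p] blk_diag_mult[symmetric]
  by (simp add: assoc_mult_mat[of _ "n * p" "n * p" _ "n * p" _ "n * p"]
      unitary_mat_cancel[OF unitary_fourier_mat[OF p, of n], of _ "n * p"])

lemma bcirc_inv_dft_adjoint:
  assumes p: "0 < p"
  shows "mat_adjoint (bcirc (inv_dft_tensor n n p C)) =
    bcirc (inv_dft_tensor n n p (\<lambda>a j i. cnj (C a i j)))"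
  unfolding bcirc_inv_dft_tensor[OF p] blk_diag_adjoint[symmetric]
  by (simp add: mat_adjoint_mult[of _ "n * p" "n * p" _ "n * p"]
      assoc_mult_mat[of _ "n * p" "n * p" _ "n * p" _ "n * p"])

text \<open>Conjugation by a unitary matrix fixes the identity, so the test can be made on each
  Fourier block. In this way inverses and unitarity pass between tensors and their blocks.\<close>

lemma bcirc_inv_dft_eq_one_iff:
  assumes p: "0 < p"
  shows "bcirc (inv_dft_tensor n n p C) = 1\<^sub>m (n * p) \<longleftrightarrow>
    (\<forall>a<p. \<forall>i<n. \<forall>j<n. C a i j = (if i = j then 1 else 0))"
proof -
  let ?F = "fourier_mat n p" and ?n = "n * p"
  note u = unitary_fourier_mat[OF p, of n]
  have "bcirc (inv_dft_tensor n n p C) = 1\<^sub>m ?n \<longleftrightarrow> blk_diag n n p C = 1\<^sub>m ?n"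
  proof
    assume "bcirc (inv_dft_tensor n n p C) = 1\<^sub>m ?n"
    then have "mat_adjoint ?F * (?F * blk_diag n n p C * mat_adjoint ?F) * ?F = mat_adjoint ?F * 1\<^sub>m ?n * ?F"
      unfolding bcirc_inv_dft_tensor[OF p] by simp
    then show "blk_diag n n p C = 1\<^sub>m ?n"
      using u by (simp add: assoc_mult_mat[of _ ?n ?n _ ?n _ ?n] unitary_mat_cancel[OF u, of _ ?n]
          unitary_mat_def right_mult_one_mat[of _ ?n ?n])
  next
    assume "blk_diag n n p C = 1\<^sub>m ?n"
    then show "bcirc (inv_dft_tensor n n p C) = 1\<^sub>m ?n"
      using u unfolding bcirc_inv_dft_tensor[OF p] by (simp add: unitary_mat_def right_mult_one_mat[of _ ?n ?n])
  qed
  also have "\<dots> \<longleftrightarrow> (\<forall>a<p. \<forall>i<n. \<forall>j<n. C a i j = (if i = j then 1 else 0))"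
  proof
    assume "blk_diag n n p C = 1\<^sub>m ?n"
    then have "blk_diag n n p C = blk_diag n n p (\<lambda>a i j. if i = j then 1 else 0)"
      by (simp add: blk_diag_one)
    note eq = blk_mat_inject[OF this[unfolded blk_diag_def]]
    show "\<forall>a<p. \<forall>i<n. \<forall>j<n. C a i j = (if i = j then 1 else 0)"
    proof (intro allI impI)
      fix a i j assume "a < p" "i < n" "j < n"
      then show "C a i j = (if i = j then 1 else 0)" using eq[of a a i j] by simp
    qed
  next
    assume "\<forall>a<p. \<forall>i<n. \<forall>j<n. C a i j = (if i = j then 1 else 0)"
    then show "blk_diag n n p C = 1\<^sub>m ?n"
      unfolding blk_diag_one[symmetric] by (intro blk_diag_cong) auto
  qed
  finally show ?thesis .
qed

lemma bcirc_inv_dft_real_diag: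
  assumes p: "0 < p"
    and "\<And>a i j. a < p \<Longrightarrow> i < n \<Longrightarrow> j < n \<Longrightarrow> C a i j = (if i = j then of_real (d (a * n + i)) else 0)"
  shows "bcirc (inv_dft_tensor n n p C) =
    fourier_mat n p * real_diag (n * p) d * mat_adjoint (fourier_mat n p)"
  unfolding bcirc_inv_dft_tensor[OF p] using assms(2) by (subst blk_diag_real_diag[of p n C d]) auto

text \<open>The Fourier factors are absorbed into the unitary ones: \<open>W = bcirc U * F\<close>
  and \<open>X = bcirc V * F\<close>, with the diagonals of \<open>Ds\<close> concatenated to
  \<open>d\<close>. Applying the function to \<open>Ds\<close> changes only the diagonal middle
  factor.\<close>

lemma tsvd_svd_mat:
  assumes A: "A \<in> carrier_tensor UNIV n n p" and p: "0 < p" and f0: "f 0 = 0"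
    and tsvd: "tsvd A U S V Ds"
    and B: "B = U *\<^sub>t bcirc_inv n n p (fourier_blocks n n p (map (gen_fun_mat f) Ds)) *\<^sub>t adjoint_tensor V"
  shows "B \<in> carrier_tensor UNIV n n p"
    and "\<exists>W d X. svd_mat (n * p) (bcirc A) W d X \<and>
      bcirc B = W * real_diag (n * p) (\<lambda>i. f (d i)) * mat_adjoint X"
proof -
  let ?n = "n * p"
  have dims: "slice_rows A = n" "slice_cols A = n" "length A = p" using carrier_tensorD[OF A] p by auto
  note tsvd' = tsvd[unfolded tsvd_def Let_def dims]
  have U: "U \<in> carrier_tensor UNIV n n p" "unitary_mat ?n (bcirc U)"
    and V: "V \<in> carrier_tensor UNIV n n p" "unitary_mat ?n (bcirc V)"
    and S: "S \<in> carrier_tensor UNIV n n p"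
    and Ds: "length Ds = p"
      "\<And>D. D \<in> set Ds \<Longrightarrow> D \<in> carrier_mat n n \<and> diagonal_mat D \<and> (\<forall>x \<in> elements_mat D. 0 \<le> x)"
    and SDs: "bcirc S = fourier_blocks n n p Ds"
    and AU: "A = U *\<^sub>t S *\<^sub>t adjoint_tensor V"
    using tsvd' unitary_tensor_iff[OF p] by auto
  have Da: "Ds ! a \<in> carrier_mat n n" "diagonal_mat (Ds ! a)" "\<forall>x \<in> elements_mat (Ds ! a). 0 \<le> x"
    if "a < p" for a using Ds(1) Ds(2)[of "Ds ! a"] that by auto
  have D0: "0 \<le> Ds ! a $$ (i, j)" if "a < p" "i < n" "j < n" for a i j
    using Da[OF that(1)] that by (auto intro: elements_matI)
  have Doff: "Ds ! a $$ (i, j) = 0" if "a < p" "i < n" "j < n" "i \<noteq> j" for a i j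
    using Da[OF that(1)] that by (auto simp: diagonal_mat_def)
  define d where "d x = Ds ! (x div n) $$ (x mod n, x mod n)" for x
  have d_nonneg: "0 \<le> d x" if "x < ?n" for x
    unfolding d_def using block_div_mod_less[OF that] by (intro D0)
  have d_eq: "d (a * n + i) = Ds ! a $$ (i, i)" if "i < n" for a i using that by (simp add: d_def)
  define F where "F = fourier_mat n p"
  have F: "unitary_mat ?n F" unfolding F_def by (rule unitary_fourier_mat[OF p])
  have F' [simp]: "F \<in> carrier_mat ?n ?n" by (simp add: F_def)
  have SF: "bcirc S = F * real_diag ?n d * mat_adjoint F"
  proof -
    have "bcirc S = bcirc (inv_dft_tensor n n p (\<lambda>a i j. of_real (Ds ! a $$ (i, j))))"
      unfolding SDs by (rule fourier_blocks_eq[OF p]) (use Ds in auto)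
    also have "\<dots> = F * real_diag ?n d * mat_adjoint F"
      unfolding F_def by (rule bcirc_inv_dft_real_diag[OF p]) (simp add: d_eq Doff)
    finally show ?thesis .
  qed
  define S' where "S' = bcirc_inv n n p (fourier_blocks n n p (map (gen_fun_mat f) Ds))"
  have fD: "gen_fun_mat f D = mat n n (\<lambda>(i, j). if 0 < D $$ (i, j) then f (D $$ (i, j)) else 0)"
    if "D \<in> set Ds" for D using gen_fun_mat_eq Ds(2)[OF that] by blast
  define G where "G = inv_dft_tensor n n p (\<lambda>a i j. of_real (map (gen_fun_mat f) Ds ! a $$ (i, j)))"
  have S'G: "S' = G"
  proof -
    have "fourier_blocks n n p (map (gen_fun_mat f) Ds) = bcirc G"
      unfolding G_def by (rule fourier_blocks_eq[OF p]) (use Ds(1) fD in auto)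
    then show ?thesis
      unfolding S'_def using bcirc_inv_bcirc[of G n n p] p by (simp add: G_def)
  qed
  have S': "S' \<in> carrier_tensor UNIV n n p" unfolding S'G G_def by simp
  \<comment> \<open>At vanishing diagonal entries \<open>gen_fun_mat\<close> puts 0 instead of
    \<open>f 0\<close>; the two agree by \<open>f 0 = 0\<close>.\<close>
  have "map (gen_fun_mat f) Ds ! a $$ (i, j) = (if i = j then f (d (a * n + i)) else 0)"
    if "a < p" "i < n" "j < n" for a i j
    using that Ds fD[of "Ds ! a"] d_eq[of i a] D0[of a i j] Doff[of a i j] f0
    by (cases "0 < Ds ! a $$ (i, j)") auto
  then have S'F: "bcirc S' = F * real_diag ?n (\<lambda>i. f (d i)) * mat_adjoint F"
    unfolding S'G G_def F_def by (intro bcirc_inv_dft_real_diag[OF p]) simp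
  have bc [simp]: "bcirc U \<in> carrier_mat ?n ?n" "bcirc V \<in> carrier_mat ?n ?n"
    using U V by (auto simp: unitary_mat_def)
  \<comment> \<open>Needed twice: with \<open>S\<close> for the decomposition of \<open>A\<close>,
    and with \<open>S'\<close> for that of \<open>B\<close>.\<close>
  have prod: "bcirc (U *\<^sub>t R *\<^sub>t adjoint_tensor V) =
      (bcirc U * F) * real_diag ?n e * mat_adjoint (bcirc V * F)"
    if "R \<in> carrier_tensor UNIV n n p" "bcirc R = F * real_diag ?n e * mat_adjoint F" for R e
    using that U(1) V(1) p
    by (simp add: bcirc_tprod[of _ n n p _ n] tprod_carrier[of _ n n p _ n] adjoint_tensor_carrier bcirc_adjoint
        mat_adjoint_mult[of _ ?n ?n _ ?n] assoc_mult_mat[of _ ?n ?n _ ?n _ ?n])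
  have "svd_mat ?n (bcirc A) (bcirc U * F) d (bcirc V * F)"
    unfolding svd_mat_def using prod[OF S SF] AU U(2) V(2) F d_nonneg
    by (auto intro: unitary_mat_mult)
  moreover have "bcirc B = (bcirc U * F) * real_diag ?n (\<lambda>i. f (d i)) * mat_adjoint (bcirc V * F)"
    unfolding B S'_def[symmetric] by (rule prod[OF S' S'F])
  ultimately show "\<exists>W d X. svd_mat ?n (bcirc A) W d X \<and>
      bcirc B = W * real_diag ?n (\<lambda>i. f (d i)) * mat_adjoint X" by blast
  show "B \<in> carrier_tensor UNIV n n p"
    unfolding B S'_def[symmetric] using U(1) V(1) S' p by (meson tprod_carrier adjoint_tensor_carrier)
qed

text \<open>An inverse of \<open>A\<close> supplies an inverse of each Fourier block, so every block
  has an SVD. Transforming the three families of factors back to tensors gives \<open>U\<close>,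
  \<open>S\<close> and \<open>V\<close>.\<close>

lemma tsvd_exists:
  assumes A: "A \<in> carrier_tensor UNIV n n p" and p: "0 < p"
    and E: "E \<in> carrier_tensor UNIV n n p" and EA: "bcirc E * bcirc A = 1\<^sub>m (n * p)"
  shows "\<exists>U S V Ds. tsvd A U S V Ds"
proof -
  obtain C where C: "A = inv_dft_tensor n n p C" using inv_dft_tensor_surj[OF A p] by blast
  obtain G where G: "E = inv_dft_tensor n n p G" using inv_dft_tensor_surj[OF E p] by blast
  define Cm where "Cm a = mat n n (\<lambda>(i, j). C a i j)" for a
  define Gm where "Gm a = mat n n (\<lambda>(i, j). G a i j)" for a
  have "Gm a * Cm a = 1\<^sub>m n" if "a < p" for a
  proof (rule eq_matI)
    fix i k assume "i < dim_row (1\<^sub>m n :: complex mat)" "k < dim_col (1\<^sub>m n :: complex mat)"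
    then show "(Gm a * Cm a) $$ (i, k) = 1\<^sub>m n $$ (i, k)"
      using EA that unfolding C G bcirc_inv_dft_mult[OF p] bcirc_inv_dft_eq_one_iff[OF p]
      by (simp add: Gm_def Cm_def scalar_prod_def atLeast0LessThan)
  qed (auto simp: Gm_def Cm_def)
  then have "\<exists>W d X. svd_mat n (Cm a) W d X" if "a < p" for a
    using that by (intro invertible_svd_mat[of _ _ "Gm a"]) (auto simp: Gm_def Cm_def)
  then obtain W d X where svd: "\<And>a. a < p \<Longrightarrow> svd_mat n (Cm a) (W a) (d a) (X a)" by metis
  define U where "U = inv_dft_tensor n n p (\<lambda>a i j. W a $$ (i, j))"
  define V where "V = inv_dft_tensor n n p (\<lambda>a i j. X a $$ (i, j))"
  define S where "S = inv_dft_tensor n n p (\<lambda>a i j. real_diag n (d a) $$ (i, j))"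
  define Ds where "Ds = map (\<lambda>a. mat n n (\<lambda>(i, j). if i = j then d a i else 0)) [0..<p]"
  have unit: "unitary_tensor n p (inv_dft_tensor n n p (\<lambda>a i j. Y a $$ (i, j)))"
    if Y: "\<And>a. a < p \<Longrightarrow> unitary_mat n (Y a)" for Y
  proof -
    have "mat_adjoint (bcirc (inv_dft_tensor n n p (\<lambda>a i j. Y a $$ (i, j)))) *
        bcirc (inv_dft_tensor n n p (\<lambda>a i j. Y a $$ (i, j))) = 1\<^sub>m (n * p)"
      unfolding bcirc_inv_dft_adjoint[OF p] bcirc_inv_dft_mult[OF p] bcirc_inv_dft_eq_one_iff[OF p]
    proof (intro allI impI)
      fix a i j assume *: "a < p" "i < n" "j < n"
      have "Y a \<in> carrier_mat n n" "mat_adjoint (Y a) * Y a = 1\<^sub>m n"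
        using Y[OF *(1)] by (auto simp: unitary_mat_def)
      moreover from this have "(mat_adjoint (Y a) * Y a) $$ (i, j) = (if i = j then 1 else 0)"
        using * by simp
      moreover from calculation have "(mat_adjoint (Y a) * Y a) $$ (i, j) =
          (\<Sum>k<n. cnj (Y a $$ (k, i)) * Y a $$ (k, j))"
        using * carrier_matD[of "Y a" n n] by (subst index_mult_mat) (auto simp: scalar_prod_def atLeast0LessThan)
      ultimately show "(\<Sum>k<n. cnj (Y a $$ (k, i)) * Y a $$ (k, j)) = (if i = j then 1 else 0)" by simp
    qed
    then show ?thesis
      unfolding unitary_tensor_iff[OF p] by (auto intro!: unitary_matI bcirc_carrier[OF inv_dft_tensor_carrier p])
  qed
  have U: "unitary_tensor n p U" unfolding U_def by (rule unit) (use svd in \<open>auto simp: svd_mat_def\<close>)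
  have V: "unitary_tensor n p V" unfolding V_def by (rule unit) (use svd in \<open>auto simp: svd_mat_def\<close>)
  have Uc: "U \<in> carrier_tensor UNIV n n p" and Vc: "V \<in> carrier_tensor UNIV n n p"
    and Sc: "S \<in> carrier_tensor UNIV n n p" by (simp_all add: U_def V_def S_def)
  \<comment> \<open>Each slice of \<open>S\<close> is a linear combination of diagonal
    matrices.\<close>
  have S_diag: "\<forall>Y \<in> set S. diagonal_mat Y"
    by (auto simp: S_def inv_dft_tensor_def tensor_of_def diagonal_mat_def real_diag_def)
  have "fourier_blocks n n p Ds = bcirc (inv_dft_tensor n n p (\<lambda>a i j. of_real (Ds ! a $$ (i, j))))"
    by (rule fourier_blocks_eq[OF p]) (auto simp: Ds_def)
  also have "\<dots> = bcirc S"
    unfolding S_def bcirc_inv_dft_tensor[OF p]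
    by (intro arg_cong2[of _ _ _ _ "(*)"] arg_cong[of _ _ "(*) (fourier_mat n p)"] blk_diag_cong refl)
      (simp add: Ds_def real_diag_def)
  finally have SDs: "bcirc S = fourier_blocks n n p Ds" by simp
  have "bcirc (U *\<^sub>t S *\<^sub>t adjoint_tensor V) = bcirc U * bcirc S * mat_adjoint (bcirc V)"
    using p Uc Vc Sc by (simp add: bcirc_tprod[of _ n n p _ n] tprod_carrier[of _ n n p _ n]
        adjoint_tensor_carrier bcirc_adjoint)
  also have "\<dots> = bcirc A"
    unfolding U_def S_def V_def C bcirc_inv_dft_adjoint[OF p] bcirc_inv_dft_mult[OF p]
    unfolding bcirc_inv_dft_tensor[OF p]
  proof (intro arg_cong2[of _ _ _ _ "(*)"] arg_cong[of _ _ "(*) (fourier_mat n p)"] blk_diag_cong refl)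
    fix a i j assume *: "a < p" "i < n" "j < n"
    note s = svd_matD[OF svd[OF *(1)]]
    have "C a i j = Cm a $$ (i, j)" using * by (simp add: Cm_def)
    also have "\<dots> = (\<Sum>k<n. (W a * real_diag n (d a)) $$ (i, k) * cnj (X a $$ (j, k)))"
      unfolding s(4) using * s(5,6) by (auto simp: scalar_prod_def atLeast0LessThan
          carrier_matD[OF real_diag_carrier] simp del: mult_square_carrier intro!: sum.cong)
    also have "\<dots> = (\<Sum>k<n. (\<Sum>l<n. W a $$ (i, l) * real_diag n (d a) $$ (l, k)) * cnj (X a $$ (j, k)))"
      using * s(5,6) by (intro sum.cong) (auto simp: scalar_prod_def atLeast0LessThan
          carrier_matD[OF real_diag_carrier] intro!: sum.cong)
    finally show "(\<Sum>k<n. (\<Sum>l<n. W a $$ (i, l) * real_diag n (d a) $$ (l, k)) * cnj (X a $$ (j, k))) = C a i j"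
      by simp
  qed
  finally have "A = U *\<^sub>t S *\<^sub>t adjoint_tensor V"
    using p Uc Vc Sc A by (intro bcirc_inject[of _ n n p])
      (auto simp: tprod_carrier[of _ n n p _ n] adjoint_tensor_carrier)
  moreover have "\<forall>D \<in> set Ds. D \<in> carrier_mat n n \<and> diagonal_mat D \<and> (\<forall>x \<in> elements_mat D. 0 \<le> x)"
    using svd by (auto simp: Ds_def diagonal_mat_def elements_mat_def svd_mat_def)
  moreover have "slice_rows A = n" "slice_cols A = n" "length A = p" using carrier_tensorD[OF A] p by auto
  moreover have "length Ds = p" by (simp add: Ds_def)
  ultimately have "tsvd A U S V Ds"
    unfolding tsvd_def Let_def using A U V Sc S_diag SDs by simp
  then show ?thesis by blast
qed

text \<open>The definite description is meaningful: a T-SVD exists because \<open>A\<close> is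
  invertible, and two candidates have equal block circulants by \<open>svd_mat_fun_unique\<close>.
  The value may then be computed from any SVD of \<open>bcirc A\<close>, even one that does not come
  from a T-SVD.\<close>

lemma gen_fun_tensor_svd:
  assumes A: "A \<in> carrier_tensor UNIV n n p" and p: "0 < p" and f0: "f 0 = 0"
    and E: "E \<in> carrier_tensor UNIV n n p" and EA: "bcirc E * bcirc A = 1\<^sub>m (n * p)"
  shows "gen_fun_tensor f A \<in> carrier_tensor UNIV n n p"
    and "svd_mat (n * p) (bcirc A) W d X \<Longrightarrow>
      bcirc (gen_fun_tensor f A) = W * real_diag (n * p) (\<lambda>i. f (d i)) * mat_adjoint X"
proof -
  have dims: "slice_rows A = n" "slice_cols A = n" "length A = p" using carrier_tensorD[OF A] p by auto
  define P where "P B \<longleftrightarrow> (\<exists>U S V Ds. tsvd A U S V Ds \<and>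
    B = U *\<^sub>t bcirc_inv n n p (fourier_blocks n n p (map (gen_fun_mat f) Ds)) *\<^sub>t adjoint_tensor V)" for B
  have gen: "gen_fun_tensor f A = (THE B. P B)"
    unfolding gen_fun_tensor_def P_def dims ..
  have PD: "B \<in> carrier_tensor UNIV n n p" "\<exists>W d X. svd_mat (n * p) (bcirc A) W d X \<and>
      bcirc B = W * real_diag (n * p) (\<lambda>i. f (d i)) * mat_adjoint X" if "P B" for B
    using that tsvd_svd_mat[where f = f, OF A p f0] unfolding P_def by blast+
  obtain B where B: "P B" using tsvd_exists[OF A p E EA] unfolding P_def by blast
  have "B' = B" if "P B'" for B'
  proof (rule bcirc_inject[OF PD(1)[OF that] PD(1)[OF B] p])
    show "bcirc B' = bcirc B"
      using PD(2)[OF that] PD(2)[OF B] svd_mat_fun_unique[of "n * p" "bcirc A" _ _ _ _ _ _ f] f0 by metis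
  qed
  then have "(THE B. P B) = B" using B by (rule the_equality[rotated])
  then have eq: "gen_fun_tensor f A = B" using gen by simp
  show "gen_fun_tensor f A \<in> carrier_tensor UNIV n n p" unfolding eq by (rule PD(1)[OF B])
  show "bcirc (gen_fun_tensor f A) = W * real_diag (n * p) (\<lambda>i. f (d i)) * mat_adjoint X"
    if "svd_mat (n * p) (bcirc A) W d X"
    unfolding eq using PD(2)[OF B] svd_mat_fun_unique[where f = f, OF that _ f0] by metis
qed

section \<open>Automorphism groups\<close>

lemma real_tensor_iff:
  assumes A: "A \<in> carrier_tensor UNIV m n p" and p: "0 < p"
  shows "A \<in> carrier_tensor \<real> m n p \<longleftrightarrow> map_mat cnj (bcirc A) = bcirc A"
proof
  assume real: "A \<in> carrier_tensor \<real> m n p"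
  have "map_mat cnj (bcirc A) = blk_mat m n p p (\<lambda>a b i j. cnj (A ! cdiff p a b $$ (i, j)))"
    unfolding bcirc_blk_mat[OF A p] by (rule eq_matI) (auto simp: blk_mat_def)
  also have "\<dots> = bcirc A"
    unfolding bcirc_blk_mat[OF A p] using carrier_tensorD(7)[OF real] p
    by (intro blk_mat_cong) (simp add: Reals_cnj_iff)
  finally show "map_mat cnj (bcirc A) = bcirc A" .
next
  assume "map_mat cnj (bcirc A) = bcirc A"
  moreover have "map_mat cnj (bcirc A) = blk_mat m n p p (\<lambda>a b i j. cnj (A ! cdiff p a b $$ (i, j)))"
    unfolding bcirc_blk_mat[OF A p] by (rule eq_matI) (auto simp: blk_mat_def)
  ultimately have eq: "blk_mat m n p p (\<lambda>a b i j. cnj (A ! cdiff p a b $$ (i, j))) =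
      blk_mat m n p p (\<lambda>a b i j. A ! cdiff p a b $$ (i, j))"
    unfolding bcirc_blk_mat[OF A p] by simp
  have "A ! k $$ (i, j) \<in> \<real>" if "k < p" "i < m" "j < n" for k i j
    using blk_mat_inject[OF eq that(1) p that(2,3)] that by (simp add: Reals_cnj_iff)
  then have "elements_mat X \<subseteq> \<real>" if "X \<in> set A" for X
    using that carrier_tensorD(1,3,4)[OF A] by (auto simp: elements_mat_def in_set_conv_nth)
  then show "A \<in> carrier_tensor \<real> m n p" using A by (simp add: carrier_tensor_def)
qed

section \<open>Bilinear and sesquilinear forms treated uniformly\<close>

fun form_op :: "form_type \<Rightarrow> complex mat \<Rightarrow> complex mat" where
  "form_op Bilinear M = transpose_mat M"
| "form_op Sesquilinear M = mat_adjoint M"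

text \<open>The discrepancy between \<open>form_op\<close> and \<open>mat_adjoint\<close>. It
  preserves unitarity and, in the factors that occur, lets one computation serve both form
  types.\<close>

fun form_conj :: "form_type \<Rightarrow> complex mat \<Rightarrow> complex mat" where
  "form_conj Bilinear M = map_mat cnj M"
| "form_conj Sesquilinear M = M"

lemma form_op_carrier [simp]: "form_op \<phi> M \<in> carrier_mat m n \<longleftrightarrow> M \<in> carrier_mat n m"
  by (cases \<phi>) auto

lemma form_op_form_op [simp]: "form_op \<phi> (form_op \<phi> M) = M"
  by (cases \<phi>) auto

lemma form_op_mult:
  assumes "A \<in> carrier_mat m n" "B \<in> carrier_mat n k"
  shows "form_op \<phi> (A * B) = form_op \<phi> B * form_op \<phi> A"
  using assms by (cases \<phi>) (auto simp: transpose_mult[of _ m n _ k] mat_adjoint_mult[of _ m n _ k])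

lemma form_op_real_diag [simp]: "form_op \<phi> (real_diag n d) = real_diag n d"
  by (cases \<phi>) auto

lemma form_op_eq: "form_op \<phi> M = mat_adjoint (form_conj \<phi> M)"
  by (cases \<phi>) (auto simp: mat_adjoint_map_cnj)

lemma form_op_adjoint: "form_op \<phi> (mat_adjoint M) = form_conj \<phi> M"
  by (metis form_op_eq form_op_form_op mat_adjoint_mat_adjoint form_conj.simps form_op.elims
      map_cnj_adjoint transpose_transpose transpose_cnj)

lemma form_conj_form_conj [simp]: "form_conj \<phi> (form_conj \<phi> M) = M"
  by (cases \<phi>) (auto intro: eq_matI)

lemma form_conj_real: "map_mat cnj M = M \<Longrightarrow> form_conj \<phi> M = M"
  by (cases \<phi>) auto

lemma unitary_form_conj: "unitary_mat n M \<Longrightarrow> unitary_mat n (form_conj \<phi> M)"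
  by (cases \<phi>) (auto intro: unitary_mat_map_cnj)

section \<open>Membership in the group as a matrix equation\<close>

lemma inv_tensor_unitary:
  assumes "unitary_tensor n p T" and p: "0 < p"
  shows "inv_tensor T = adjoint_tensor T"
  using assms by (intro inv_tensor_eq[OF _ _ p])
    (auto simp: unitary_tensor_iff unitary_mat_def bcirc_adjoint intro: adjoint_tensor_carrier)

lemma star_adjoint_tensor:
  assumes T: "unitary_tensor n p T" and A: "A \<in> carrier_tensor UNIV n n p" and p: "0 < p"
  shows "star_adjoint \<phi> T A \<in> carrier_tensor UNIV n n p"
    and "bcirc (star_adjoint \<phi> T A) = mat_adjoint (bcirc T) * form_op \<phi> (bcirc A) * bcirc T"
proof -
  have "T \<in> carrier_tensor UNIV n n p" using T by (simp add: unitary_tensor_def)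
  note c = this adjoint_tensor_carrier[OF this] transpose_tensor_carrier[OF A] adjoint_tensor_carrier[OF A]
  show "star_adjoint \<phi> T A \<in> carrier_tensor UNIV n n p"
    using c p by (cases \<phi>) (auto simp: inv_tensor_unitary[OF T p] intro!: tprod_carrier)
  show "bcirc (star_adjoint \<phi> T A) = mat_adjoint (bcirc T) * form_op \<phi> (bcirc A) * bcirc T"
    using c A p by (cases \<phi>) (simp_all add: inv_tensor_unitary[OF T p] bcirc_tprod[of _ n n p _ n]
        tprod_carrier[of _ n n p _ n] bcirc_adjoint bcirc_transpose)
qed

text \<open>A left inverse of the square matrix \<open>bcirc A\<close> is two-sided and unique, so a
  single equation expresses both invertibility and equality with
  \<open>inv_tensor A\<close>.\<close>

lemma automorphism_group_iff:
  assumes T: "unitary_tensor n p T" and p: "0 < p"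
  shows "A \<in> automorphism_group K n p T \<phi> \<longleftrightarrow>
    A \<in> carrier_tensor K n n p \<and>
    mat_adjoint (bcirc T) * form_op \<phi> (bcirc A) * bcirc T * bcirc A = 1\<^sub>m (n * p)"
proof (cases "A \<in> carrier_tensor K n n p")
  case True
  then have A: "A \<in> carrier_tensor UNIV n n p" by (rule carrier_tensor_UNIV)
  note star = star_adjoint_tensor[OF T A p, of \<phi>]
  note bA = bcirc_carrier[OF A p] and bS = bcirc_carrier[OF star(1) p]
  have "invertible_tensor A \<and> star_adjoint \<phi> T A = inv_tensor A \<longleftrightarrow>
      bcirc (star_adjoint \<phi> T A) * bcirc A = 1\<^sub>m (n * p)"
  proof
    assume *: "invertible_tensor A \<and> star_adjoint \<phi> T A = inv_tensor A"
    then obtain B where "inverse_tensor_of A B" by (auto simp: invertible_tensor_def)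
    then have B: "B \<in> carrier_tensor UNIV n n p" "bcirc A * bcirc B = 1\<^sub>m (n * p)"
      using inverse_tensor_of_iff[OF A p] by auto
    then have "star_adjoint \<phi> T A = B" using * inv_tensor_eq[OF A B(1) p B(2)] by simp
    then show "bcirc (star_adjoint \<phi> T A) * bcirc A = 1\<^sub>m (n * p)"
      using mat_mult_left_right_inverse[OF bA bcirc_carrier[OF B(1) p] B(2)] by simp
  next
    assume "bcirc (star_adjoint \<phi> T A) * bcirc A = 1\<^sub>m (n * p)"
    then have *: "bcirc A * bcirc (star_adjoint \<phi> T A) = 1\<^sub>m (n * p)"
      by (rule mat_mult_left_right_inverse[OF bS bA])
    then have "inverse_tensor_of A (star_adjoint \<phi> T A)"
      using inverse_tensor_of_iff[OF A p] star(1) by simp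
    then show "invertible_tensor A \<and> star_adjoint \<phi> T A = inv_tensor A"
      using inv_tensor_eq[OF A star(1) p *] by (auto simp: invertible_tensor_def)
  qed
  then show ?thesis using True by (simp add: automorphism_group_def star(2))
qed (simp add: automorphism_group_def)

text \<open>Moving the unitary factors to the other side shows that
  \<open>mat_adjoint X * R * W\<close> is a left inverse of the diagonal factor, whose entries are
  therefore nonzero. Inverting the three factors of \<open>M\<close> then gives \<open>R\<close>, by
  uniqueness of inverses.\<close>

lemma svd_mat_left_inverse:
  assumes s: "svd_mat n M W d X" and R: "R \<in> carrier_mat n n" and RM: "R * M = 1\<^sub>m n"
  shows "\<And>i. i < n \<Longrightarrow> 0 < d i"
    and "R = X * real_diag n (\<lambda>i. 1 / d i) * mat_adjoint W"
proof -
  note c = svd_matD[OF s]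
  note [simp] = c(5,6,7) R
  have eq: "(mat_adjoint X * R * W) * real_diag n d = 1\<^sub>m n"
  proof -
    have "(mat_adjoint X * R * W) * real_diag n d = mat_adjoint X * (R * (M * X))"
      using c(2) unfolding c(4) by (simp add: assoc_mult_mat[of _ n n _ n _ n] unitary_mat_def
          right_mult_one_mat[of _ n n])
    also have "R * (M * X) = X" by (rule mult_cancel_left_inverse[OF RM, of _ n]) auto
    finally show ?thesis using c(2) by (simp add: unitary_mat_def)
  qed
  show pos: "0 < d i" if i: "i < n" for i
  proof -
    have "(mat_adjoint X * R * W) $$ (i, i) * of_real (d i) = 1"
      using arg_cong[OF eq, of "\<lambda>A. A $$ (i, i)"] i
      by (simp add: mult_real_diag_index[of _ n n] del: index_mult_mat)
    then have "d i \<noteq> 0" by auto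
    then show ?thesis using c(3)[OF i] by simp
  qed
  have inv: "real_diag n d * real_diag n (\<lambda>i. 1 / d i) = 1\<^sub>m n"
    unfolding real_diag_mult
  proof (rule real_diag_eq_one)
    fix i assume "i < n"
    with pos[of i] show "d i * (1 / d i) = 1" by simp
  qed
  have "M * (X * real_diag n (\<lambda>i. 1 / d i) * mat_adjoint W) =
      W * (real_diag n d * real_diag n (\<lambda>i. 1 / d i)) * mat_adjoint W"
    unfolding c(4) by (simp add: assoc_mult_mat[of _ n n _ n _ n] unitary_mat_cancel[OF c(2), of _ n])
  also have "\<dots> = 1\<^sub>m n" unfolding inv using c(1) by (simp add: right_mult_one_mat[of _ n n] unitary_mat_def)
  finally have "R * (M * (X * real_diag n (\<lambda>i. 1 / d i) * mat_adjoint W)) = R"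
    by (simp add: right_mult_one_mat[of _ n n])
  then show "R = X * real_diag n (\<lambda>i. 1 / d i) * mat_adjoint W"
    using mult_cancel_left_inverse[OF RM c(7) R, of "X * real_diag n (\<lambda>i. 1 / d i) * mat_adjoint W" n]
    by simp
qed

text \<open>The group condition reads \<open>M = T M\<^sup>-\<^sup>* T\<^sup>-\<^sup>1\<close>, where \<open>*\<close> is the involution of the form. Hence an
  SVD of \<open>M\<close> with singular values \<open>\<sigma>\<close> yields a second one with singular values \<open>1 / \<sigma>\<close>, and the
  values of \<open>f\<close> computed from the two agree.\<close>

lemma svd_mat_fun_automorphism:
  assumes t: "unitary_mat n t" and t_real: "map_mat cnj t = t"
    and s: "svd_mat n M W d X"
    and M: "mat_adjoint t * form_op \<phi> M * t * M = 1\<^sub>m n"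
    and f: "\<And>x. x > 0 \<Longrightarrow> f x * f (1 / x) = 1" and f0: "f 0 = 0"
    and g: "g = W * real_diag n (\<lambda>i. f (d i)) * mat_adjoint X"
  shows "mat_adjoint t * form_op \<phi> g * t * g = 1\<^sub>m n"
proof -
  note c = svd_matD[OF s]
  have tc: "t \<in> carrier_mat n n" using t by (simp add: unitary_mat_def)
  define cW where "cW = form_conj \<phi> W"
  define cX where "cX = form_conj \<phi> X"
  have u: "unitary_mat n cW" "unitary_mat n cX"
    unfolding cW_def cX_def using c(1,2) by (auto intro: unitary_form_conj)
  have [simp]: "cW \<in> carrier_mat n n" "cX \<in> carrier_mat n n" using u by (auto simp: unitary_mat_def)
  note [simp] = c(5,6,7) tc
  note A = assoc_mult_mat[of _ n n _ n _ n]
  note op_mult = form_op_mult[of _ n n _ n]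
  \<comment> \<open>Since \<open>t\<close> is real, its transpose and its adjoint coincide, so the
    form type does not matter for \<open>t\<close>.\<close>
  have op_t: "form_op \<phi> t = mat_adjoint t" "form_op \<phi> (mat_adjoint t) = t"
    using form_conj_real[OF t_real] by (simp_all add: form_op_eq[of _ t] form_op_adjoint)
  have op_X: "form_op \<phi> X = mat_adjoint cX" "form_op \<phi> (mat_adjoint W) = cW"
    "form_op \<phi> (mat_adjoint cX) = X" "form_op \<phi> cW = mat_adjoint W"
    by (simp_all add: form_op_adjoint cW_def cX_def) (simp_all add: form_op_eq)
  define R where "R = mat_adjoint t * form_op \<phi> M * t"
  have R [simp]: "R \<in> carrier_mat n n" by (simp add: R_def)
  have RM: "R * M = 1\<^sub>m n" using M by (simp add: R_def)
  note pos = svd_mat_left_inverse(1)[OF s R RM] and R_eq = svd_mat_left_inverse(2)[OF s R RM]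
  have "form_op \<phi> M = t * R * mat_adjoint t"
    using t by (simp add: R_def A unitary_mat_cancel[OF t, of _ n] unitary_mat_def
        right_mult_one_mat[of _ n n])
  \<comment> \<open>Applying the involution of the form once more recovers \<open>M\<close>. It
    turns the factors of \<open>R\<close> into \<open>cW\<close> and \<open>cX\<close> and keeps the
    reciprocal singular values.\<close>
  then have "M = form_op \<phi> (t * R * mat_adjoint t)"
    by (metis form_op_form_op)
  also have "\<dots> = (t * cW) * real_diag n (\<lambda>i. 1 / d i) * mat_adjoint (t * cX)"
    unfolding R_eq by (simp add: op_mult op_t op_X A mat_adjoint_mult[of _ n n _ n])
  finally have "svd_mat n M (t * cW) (\<lambda>i. 1 / d i) (t * cX)"
    unfolding svd_mat_def using t u pos by (auto intro: unitary_mat_mult less_imp_le)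
  then have "g = (t * cW) * real_diag n (\<lambda>i. f (1 / d i)) * mat_adjoint (t * cX)"
    unfolding g by (rule svd_mat_fun_unique[where f = f, OF s _ f0])
  then have "form_op \<phi> g = t * (X * (real_diag n (\<lambda>i. f (1 / d i)) * (mat_adjoint W * mat_adjoint t)))"
    by (simp add: op_mult op_t op_X A mat_adjoint_mult[of _ n n _ n])
  then have "mat_adjoint t * form_op \<phi> g * t = X * (real_diag n (\<lambda>i. f (1 / d i)) * mat_adjoint W)"
    using t by (simp add: A unitary_mat_cancel[OF t, of _ n] unitary_mat_def right_mult_one_mat[of _ n n])
  \<comment> \<open>The unitary factors between the two diagonal matrices cancel, and the entries
    \<open>f (1 / d i)\<close> meet \<open>f (d i)\<close>; the functional equation applies because
    every \<open>d i\<close> is positive.\<close>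
  then have "mat_adjoint t * form_op \<phi> g * t * g =
      X * ((real_diag n (\<lambda>i. f (1 / d i)) * real_diag n (\<lambda>i. f (d i))) * mat_adjoint X)"
    unfolding g by (simp add: A unitary_mat_cancel[OF c(1), of _ n])
  also have "real_diag n (\<lambda>i. f (1 / d i)) * real_diag n (\<lambda>i. f (d i)) = 1\<^sub>m n"
    unfolding real_diag_mult using f pos by (intro real_diag_eq_one) (simp add: mult.commute)
  also have "X * (1\<^sub>m n * mat_adjoint X) = 1\<^sub>m n"
    using c(2) by (simp add: unitary_mat_def left_mult_one_mat[of _ n n])
  finally show ?thesis .
qed

text \<open>Conjugating every factor of an SVD of a real matrix gives another SVD of it with the
  same singular values; uniqueness identifies \<open>g\<close> with its conjugate.\<close>

lemma svd_mat_fun_real: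
  assumes s: "svd_mat n M W d X" and M: "map_mat cnj M = M" and f0: "f 0 = 0"
    and g: "g = W * real_diag n (\<lambda>i. f (d i)) * mat_adjoint X"
  shows "map_mat cnj g = g"
proof -
  note c = svd_matD[OF s]
  note [simp] = c(5,6)
  have cnj: "map_mat cnj (W * real_diag n e * mat_adjoint X) =
      map_mat cnj W * real_diag n e * mat_adjoint (map_mat cnj X)" for e
    by (simp add: map_cnj_mult[of _ n n _ n] map_cnj_adjoint mat_adjoint_map_cnj)
  have "svd_mat n M (map_mat cnj W) d (map_mat cnj X)"
    unfolding svd_mat_def using c(1,2,3) cnj[of d] M c(4) by (auto intro: unitary_mat_map_cnj)
  then show ?thesis
    unfolding g cnj by (rule svd_mat_fun_unique[where f = f, OF _ s f0])
qed

text \<open>The individual spaces enter only through these facts: \<open>T\<close> is unitary and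
  real, and the scalars are all complex or all real numbers. In the real case it must also be shown
  that the function keeps the tensor real.\<close>

lemma gen_fun_tensor_automorphism:
  assumes p: "0 < p" and T: "unitary_tensor n p T" "T \<in> carrier_tensor \<real> n n p"
    and K: "K = UNIV \<or> K = \<real>"
    and A: "A \<in> automorphism_group K n p T \<phi>"
    and f: "\<And>x. x > 0 \<Longrightarrow> f x * f (1 / x) = 1" and f0: "f 0 = 0"
  shows "gen_fun_tensor f A \<in> automorphism_group K n p T \<phi>"
proof -
  let ?n = "n * p"
  note A' = A[unfolded automorphism_group_iff[OF T(1) p]]
  have AU: "A \<in> carrier_tensor UNIV n n p" using A' carrier_tensor_UNIV by blast
  note star = star_adjoint_tensor[OF T(1) AU p, of \<phi>]
  have SA: "bcirc (star_adjoint \<phi> T A) * bcirc A = 1\<^sub>m ?n" using A' star(2) by simp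
  obtain W d X where s: "svd_mat ?n (bcirc A) W d X"
    using invertible_svd_mat[OF bcirc_carrier[OF AU p] bcirc_carrier[OF star(1) p] SA] by blast
  note gen = gen_fun_tensor_svd[where f = f, OF AU p f0 star(1) SA]
  note g = gen(2)[OF s]
  have t: "unitary_mat ?n (bcirc T)" "map_mat cnj (bcirc T) = bcirc T"
    using T unitary_tensor_iff[OF p] real_tensor_iff[OF carrier_tensor_UNIV[OF T(2)] p] by auto
  have "mat_adjoint (bcirc T) * form_op \<phi> (bcirc (gen_fun_tensor f A)) * bcirc T *
      bcirc (gen_fun_tensor f A) = 1\<^sub>m ?n"
    using A' by (intro svd_mat_fun_automorphism[where f = f, OF t s _ f f0 g]) auto
  moreover have "gen_fun_tensor f A \<in> carrier_tensor K n n p"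
    using K
  proof
    assume K: "K = \<real>"
    have "map_mat cnj (bcirc A) = bcirc A" using A' K real_tensor_iff[OF AU p] by simp
    then have "map_mat cnj (bcirc (gen_fun_tensor f A)) = bcirc (gen_fun_tensor f A)"
      by (rule svd_mat_fun_real[where f = f, OF s _ f0 g])
    then show ?thesis using K real_tensor_iff[OF gen(1) p] by simp
  qed (use gen(1) in simp)
  ultimately show ?thesis by (simp add: automorphism_group_iff[OF T(1) p])
qed

section \<open>The tensors of the listed spaces are real and unitary\<close>

lemma length_first_slice_tensor: "0 < p \<Longrightarrow> length (first_slice_tensor p M) = p"
  by (simp add: first_slice_tensor_def)

text \<open>Reduces each space to the check that a single real matrix is orthogonal: the block
  circulant repeats \<open>Q\<close> along the diagonal, and for real \<open>Q\<close> the adjoint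
  repeats its transpose.\<close>

lemma first_slice_tensor_orthogonal:
  assumes Q: "Q \<in> carrier_mat n n" and real: "\<And>i j. i < n \<Longrightarrow> j < n \<Longrightarrow> Q $$ (i, j) \<in> \<real>"
    and QQ: "transpose_mat Q * Q = 1\<^sub>m n" and p: "0 < p"
  shows "unitary_tensor n p (first_slice_tensor p Q) \<and> first_slice_tensor p Q \<in> carrier_tensor \<real> n n p"
proof
  let ?T = "first_slice_tensor p Q"
  have c: "transpose_mat Q \<in> carrier_mat n n" using Q by simp
  have adj: "mat_adjoint (bcirc ?T) = bcirc (first_slice_tensor p (transpose_mat Q))"
    unfolding bcirc_first_slice_tensor[OF Q p] bcirc_first_slice_tensor[OF c p] blk_mat_adjoint
    using Q real by (intro blk_mat_cong) (auto simp: Reals_cnj_iff)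
  have "mat_adjoint (bcirc ?T) * bcirc ?T = 1\<^sub>m (n * p)"
    unfolding adj bcirc_first_slice_tensor_mult[OF c Q p] QQ using bcirc_id_tensor[OF p]
    by (simp add: id_tensor_def)
  then show "unitary_tensor n p ?T"
    unfolding unitary_tensor_iff[OF p] using first_slice_tensor_carrier[OF Q p]
    by (auto intro!: unitary_matI bcirc_carrier[OF first_slice_tensor_carrier[OF Q p] p])
  have "elements_mat Q \<subseteq> \<real>" "elements_mat (0\<^sub>m n n) \<subseteq> (\<real> :: complex set)"
    using Q real by (auto simp: elements_mat_def)
  then show "?T \<in> carrier_tensor \<real> n n p"
    using Q p by (auto simp: first_slice_tensor_def carrier_tensor_def)
qed

text \<open>In every slice after the first all four blocks are zero, the negated one included, so
  the tensor is determined by its first slice.\<close>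

lemma signature_tensor_eq:
  assumes "0 < p"
  shows "signature_tensor a b p =
    first_slice_tensor p (four_block_mat (1\<^sub>m a) (0\<^sub>m a b) (0\<^sub>m b a) (- 1\<^sub>m b))"
  using assms
  by (intro nth_equalityI) (auto simp: signature_tensor_def block_tensor_def id_tensor_def zero_tensor_def
      length_first_slice_tensor nth_first_slice_tensor)

lemma symplectic_tensor_eq:
  assumes "0 < p"
  shows "symplectic_tensor n p =
    first_slice_tensor p (four_block_mat (0\<^sub>m n n) (1\<^sub>m n) (- 1\<^sub>m n) (0\<^sub>m n n))"
  using assms
  by (intro nth_equalityI) (auto simp: symplectic_tensor_def block_tensor_def id_tensor_def zero_tensor_def
      length_first_slice_tensor nth_first_slice_tensor)

lemma id_tensor_orthogonal:
  assumes "0 < p"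
  shows "unitary_tensor n p (id_tensor n p) \<and> id_tensor n p \<in> carrier_tensor \<real> n n p"
  unfolding id_tensor_def using assms by (intro first_slice_tensor_orthogonal) auto

lemma signature_tensor_orthogonal:
  assumes "0 < p"
  shows "unitary_tensor (a + b) p (signature_tensor a b p) \<and>
    signature_tensor a b p \<in> carrier_tensor \<real> (a + b) (a + b) p"
  unfolding signature_tensor_eq[OF assms]
proof (rule first_slice_tensor_orthogonal[OF _ _ _ assms])
  let ?Q = "four_block_mat (1\<^sub>m a) (0\<^sub>m a b) (0\<^sub>m b a) (- 1\<^sub>m b) :: complex mat"
  show "?Q \<in> carrier_mat (a + b) (a + b)" by simp
  show "?Q $$ (i, j) \<in> \<real>" if "i < a + b" "j < a + b" for i j using that by auto
  have transp: "transpose_mat ?Q = ?Q" by (rule eq_matI) auto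
  have "transpose_mat ?Q * ?Q =
      four_block_mat (1\<^sub>m a * 1\<^sub>m a) (0\<^sub>m a b) (0\<^sub>m b a) (- 1\<^sub>m b * - 1\<^sub>m b)"
    unfolding transp by (rule four_block_diag_mult) auto
  also have "- 1\<^sub>m b * - 1\<^sub>m b = (1\<^sub>m b :: complex mat)"
    by (simp add: uminus_mult_left_mat uminus_mult_right_mat)
  finally show "transpose_mat ?Q * ?Q = 1\<^sub>m (a + b)" by simp
qed

lemma symplectic_tensor_orthogonal:
  assumes "0 < p"
  shows "unitary_tensor (2 * n) p (symplectic_tensor n p) \<and>
    symplectic_tensor n p \<in> carrier_tensor \<real> (2 * n) (2 * n) p"
  unfolding symplectic_tensor_eq[OF assms] mult_2
proof (rule first_slice_tensor_orthogonal[OF _ _ _ assms])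
  let ?Q = "four_block_mat (0\<^sub>m n n) (1\<^sub>m n) (- 1\<^sub>m n) (0\<^sub>m n n) :: complex mat"
  show "?Q \<in> carrier_mat (n + n) (n + n)" by simp
  show "?Q $$ (i, j) \<in> \<real>" if "i < n + n" "j < n + n" for i j using that by auto
  have transp: "transpose_mat ?Q = four_block_mat (0\<^sub>m n n) (- 1\<^sub>m n) (1\<^sub>m n) (0\<^sub>m n n)"
    by (rule eq_matI) auto
  have "transpose_mat ?Q * ?Q = four_block_mat
      (0\<^sub>m n n * 0\<^sub>m n n + - 1\<^sub>m n * - 1\<^sub>m n) (0\<^sub>m n n * 1\<^sub>m n + - 1\<^sub>m n * 0\<^sub>m n n)
      (1\<^sub>m n * 0\<^sub>m n n + 0\<^sub>m n n * - 1\<^sub>m n) (1\<^sub>m n * 1\<^sub>m n + 0\<^sub>m n n * 0\<^sub>m n n)"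
    unfolding transp by (rule mult_four_block_mat) auto
  also have "\<dots> = 1\<^sub>m (n + n)"
    by (simp add: uminus_mult_left_mat uminus_mult_right_mat, intro eq_matI) auto
  finally show "transpose_mat ?Q * ?Q = 1\<^sub>m (n + n)" .
qed

lemma reversal_tensor_orthogonal:
  assumes "0 < p"
  shows "unitary_tensor n p (reversal_tensor n p) \<and> reversal_tensor n p \<in> carrier_tensor \<real> n n p"
  unfolding reversal_tensor_def
proof (rule first_slice_tensor_orthogonal[OF _ _ _ assms])
  let ?Q = "mat n n (\<lambda>(i, j). if i + j + 1 = n then 1 else 0) :: complex mat"
  show "?Q \<in> carrier_mat n n" by simp
  show "?Q $$ (i, j) \<in> \<real>" if "i < n" "j < n" for i j using that by auto
  show "transpose_mat ?Q * ?Q = 1\<^sub>m n"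
  proof (rule eq_matI)
    fix i j assume "i < dim_row (1\<^sub>m n :: complex mat)" "j < dim_col (1\<^sub>m n :: complex mat)"
    then have ij: "i < n" "j < n" by auto
    have "(transpose_mat ?Q * ?Q) $$ (i, j) =
        (\<Sum>k<n. (if k + i + 1 = n then 1 else 0) * (if k + j + 1 = n then 1 else 0))"
      using ij by (simp add: scalar_prod_def atLeast0LessThan)
    \<comment> \<open>Only \<open>k = n - 1 - i\<close> satisfies the first condition, and it
      satisfies the second exactly when \<open>i = j\<close>.\<close>
    also have "\<dots> = (\<Sum>k<n. if k = n - 1 - i then if i = j then 1 else 0 else 0)"
      using ij by (intro sum.cong) auto
    also have "\<dots> = (if i = j then 1 else 0)" using ij by simp
    finally show "(transpose_mat ?Q * ?Q) $$ (i, j) = 1\<^sub>m n $$ (i, j)" using ij by simp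
  qed auto
qed

lemma classical_space_orthogonal:
  assumes "classical_space K n p T \<phi>" and p: "0 < p"
  shows "unitary_tensor n p T \<and> T \<in> carrier_tensor \<real> n n p \<and> (K = UNIV \<or> K = \<real>)"
  using assms(1)
  by cases (use id_tensor_orthogonal[OF p] signature_tensor_orthogonal[OF p]
      symplectic_tensor_orthogonal[OF p] reversal_tensor_orthogonal[OF p] in auto)

theorem theorem10:
  fixes f :: "real \<Rightarrow> real" and K :: "complex set" and N p :: nat
    and T A :: "complex tensor" and \<phi> :: form_type
  assumes "0 < N" and "0 < p"
    and "classical_space K N p T \<phi>"
    and "A \<in> automorphism_group K N p T \<phi>"
    and "\<And>x. x > 0 \<Longrightarrow> f x * f (1 / x) = 1"
    and "f 0 = 0"
  shows "gen_fun_tensor f A \<in> automorphism_group K N p T \<phi>"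
  using classical_space_orthogonal[OF assms(3,2)] assms(2,4-6)
  by (intro gen_fun_tensor_automorphism) auto

end
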